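(* Let $V$ be a finite set, let $\mathcal{P}$ be a complete collection of effect-margin pairs over $V$, and let $v \in V$ be such that $v$ does not belong to any margin in $\mathcal{P}$ other than $V$ itself. Then $\boldsymbol\lambda_{\mathcal{P}}$ is a smooth parameterization of the strictly positive distributions of $X_V$ if and only if $\boldsymbol\lambda_{\mathcal{P}_{-v}}$ is a smooth parameterization of the strictly positive distributions of $X_{V \setminus \{v\}}$, where $$\mathcal{P}_{-v} = \{(L, M \setminus \{v\}) : (L, M) \in \mathcal{P},\ v \notin L\}.$$ In addition, $\boldsymbol\lambda_{\mathcal{P}}$ is variation independent if and only if $\boldsymbol\lambda_{\mathcal{P}_{-v}}$ is variation independent.
   Context: $V$ is a finite set and $X_V = (X_v)_{v\in V}$ is a vector of binary random variables, $X_v \in \{0,1\}$, with strictly positive joint distribution $p_V$. For $M \subseteq V$, $p_M$ is the marginal distribution of $X_M = (X_v)_{v\in M}$, and $|x_L| = \sum_{v\in L} x_v$. Marginal log-linear parameters: for $L \subseteq M \subseteq V$, $$\lambda_L^M = 2^{-|M|} \sum_{x_M \in \{0,1\}^M} (-1)^{|x_L|} \log p_M(x_M);$$ $L$ is called the effect and $M$ the margin. Let $\mathcal{P}$ be a collection of effect-margin pairs $(L,M)$ with $\emptyset \neq L \subseteq M \subseteq V$, and put $\boldsymbol\lambda_{\mathcal{P}} = \boldsymbol\lambda_{\mathcal P}(p_V) = (\lambda_L^M : (L,M) \in \mathcal{P})$. The margins in $\mathcal{P}$ are the sets $M$ with $(L,M)\in\mathcal{P}$ for some $L$. $\mathcal{P}$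 is complete (over $V$) if every non-empty subset of $V$ appears as an effect in $\mathcal{P}$ exactly once. Smooth parameterization: let $\Delta^k$ be the set of strictly positive distributions $p_V$ on $\{0,1\}^V$, of dimension $k = 2^{|V|}-1$. A map $\theta : \Delta^k \to \Theta \subseteq \mathbb{R}^k$ is a smooth parameterization if it is a homeomorphism onto an open set $\Theta$, is twice continuously differentiable, and its Jacobian has full rank $k$ everywhere. The same definitions are used with $V \setminus \{v\}$ in place of $V$. A parameterization $\boldsymbol\lambda_{\mathcal{P}}$ is variation independent if its range over strictly positive distributions is all of $\mathbb{R}^{|\mathcal{P}|}$ (every real vector corresponds to a valid distribution). *)

theory Defs
  imports "HOL-Analysis.Analysis" "HOL-Library.Function_Algebras"
begin

text \<open>
  A state of \<open>X\<^sub>M\<close> is an extensional function in \<open>{0,1}\<^sup>M\<close>, and a distribution of \<open>X\<^sub>M\<close> is given by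
  its probability mass function, an extensional function on the states.
\<close>

definition states :: "'a set \<Rightarrow> ('a \<Rightarrow> nat) set" where
  "states M = M \<rightarrow>\<^sub>E {0, 1}"

definition pos_dists :: "'a set \<Rightarrow> (('a \<Rightarrow> nat) \<Rightarrow> real) set" where
  "pos_dists V = {p \<in> states V \<rightarrow>\<^sub>E {0<..}. (\<Sum>x\<in>states V. p x) = 1}"

definition marginal :: "'a set \<Rightarrow> 'a set \<Rightarrow> (('a \<Rightarrow> nat) \<Rightarrow> real) \<Rightarrow> ('a \<Rightarrow> nat) \<Rightarrow> real" where
  "marginal V M p = (\<lambda>y\<in>states M. \<Sum>x | x \<in> states V \<and> restrict x M = y. p x)"

definition mll :: "'a set \<Rightarrow> 'a set \<Rightarrow> 'a set \<Rightarrow> (('a \<Rightarrow> nat) \<Rightarrow> real) \<Rightarrow> real" where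
  "mll V L M p =
     (1 / 2 ^ card M) * (\<Sum>y\<in>states M. (-1) ^ (\<Sum>v\<in>L. y v) * ln (marginal V M p y))"

definition mll_vec ::
    "'a set \<Rightarrow> ('a set \<times> 'a set) set \<Rightarrow> (('a \<Rightarrow> nat) \<Rightarrow> real) \<Rightarrow> ('a set \<times> 'a set \<Rightarrow> real)" where
  "mll_vec V P p = (\<lambda>(L, M)\<in>P. mll V L M p)"

definition effect_margin_pairs :: "'a set \<Rightarrow> ('a set \<times> 'a set) set \<Rightarrow> bool" where
  "effect_margin_pairs V P \<longleftrightarrow> (\<forall>(L, M)\<in>P. L \<noteq> {} \<and> L \<subseteq> M \<and> M \<subseteq> V)"

definition margins :: "('a set \<times> 'a set) set \<Rightarrow> 'a set set" where
  "margins P = {M. \<exists>L. (L, M) \<in> P}"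

definition complete_pairs :: "'a set \<Rightarrow> ('a set \<times> 'a set) set \<Rightarrow> bool" where
  "complete_pairs V P \<longleftrightarrow>
     effect_margin_pairs V P \<and> (\<forall>L. L \<noteq> {} \<and> L \<subseteq> V \<longrightarrow> (\<exists>!M. (L, M) \<in> P))"

definition remove_vertex :: "'a \<Rightarrow> ('a set \<times> 'a set) set \<Rightarrow> ('a set \<times> 'a set) set" where
  "remove_vertex v P = {(L, M - {v}) | L M. (L, M) \<in> P \<and> v \<notin> L}"

text \<open>
  Differentiation on the simplex uses the usual chart that drops one probability: the coordinates
  are \<open>p x\<close> for the states \<open>x\<close> other than the all-zero state, whose probability is one minus the sum
  of the others. Increasing the coordinate \<open>p x\<close> by \<open>t\<close> therefore lowers the probability of the
  all-zero state by \<open>t\<close>.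
\<close>

definition zero_state :: "'a set \<Rightarrow> 'a \<Rightarrow> nat" where
  "zero_state V = (\<lambda>v\<in>V. 0)"

definition chart_states :: "'a set \<Rightarrow> ('a \<Rightarrow> nat) set" where
  "chart_states V = states V - {zero_state V}"

definition move ::
    "'a set \<Rightarrow> ('a \<Rightarrow> nat) \<Rightarrow> real \<Rightarrow> (('a \<Rightarrow> nat) \<Rightarrow> real) \<Rightarrow> (('a \<Rightarrow> nat) \<Rightarrow> real)" where
  "move V x t p = p(x := p x + t, zero_state V := p (zero_state V) - t)"

definition has_partials :: "'a set \<Rightarrow> ((('a \<Rightarrow> nat) \<Rightarrow> real) \<Rightarrow> real) \<Rightarrow> bool" where
  "has_partials V f \<longleftrightarrow>
     (\<forall>p\<in>pos_dists V. \<forall>x\<in>chart_states V. (\<lambda>t. f (move V x t p)) differentiable (at 0))"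

definition partial ::
    "'a set \<Rightarrow> ('a \<Rightarrow> nat) \<Rightarrow> ((('a \<Rightarrow> nat) \<Rightarrow> real) \<Rightarrow> real) \<Rightarrow> (('a \<Rightarrow> nat) \<Rightarrow> real) \<Rightarrow> real" where
  "partial V x f p = deriv (\<lambda>t. f (move V x t p)) 0"

abbreviation simplex_top :: "'a set \<Rightarrow> (('a \<Rightarrow> nat) \<Rightarrow> real) topology" where
  "simplex_top V \<equiv> subtopology (powertop_real (states V)) (pos_dists V)"

fun cont_diff :: "nat \<Rightarrow> 'a set \<Rightarrow> ((('a \<Rightarrow> nat) \<Rightarrow> real) \<Rightarrow> real) \<Rightarrow> bool" where
  "cont_diff 0 V f \<longleftrightarrow> continuous_map (simplex_top V) euclideanreal f"
| "cont_diff (Suc n) V f \<longleftrightarrow>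
     continuous_map (simplex_top V) euclideanreal f \<and> has_partials V f \<and>
     (\<forall>x\<in>chart_states V. cont_diff n V (partial V x f))"

text \<open>
  The Jacobian at \<open>p\<close> has rows indexed by \<open>I\<close> and columns by \<open>chart_states V\<close>; its rank is the
  dimension of the space spanned by its columns, which are extended by \<open>0\<close> outside \<open>I\<close>.
\<close>

definition jacobian_column ::
    "'a set \<Rightarrow> 'i set \<Rightarrow> ((('a \<Rightarrow> nat) \<Rightarrow> real) \<Rightarrow> 'i \<Rightarrow> real) \<Rightarrow> (('a \<Rightarrow> nat) \<Rightarrow> real) \<Rightarrow>
     ('a \<Rightarrow> nat) \<Rightarrow> 'i \<Rightarrow> real" where
  "jacobian_column V I \<theta> p x = (\<lambda>i. if i \<in> I then partial V x (\<lambda>q. \<theta> q i) p else 0)"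

definition fun_scale :: "real \<Rightarrow> ('i \<Rightarrow> real) \<Rightarrow> 'i \<Rightarrow> real" where
  "fun_scale c f = (\<lambda>i. c * f i)"

lemma vector_space_fun_scale: "vector_space fun_scale"
  by unfold_locales (auto simp: fun_scale_def fun_eq_iff algebra_simps)

definition jacobian_rank ::
    "'a set \<Rightarrow> 'i set \<Rightarrow> ((('a \<Rightarrow> nat) \<Rightarrow> real) \<Rightarrow> 'i \<Rightarrow> real) \<Rightarrow> (('a \<Rightarrow> nat) \<Rightarrow> real) \<Rightarrow> nat" where
  "jacobian_rank V I \<theta> p = vector_space.dim fun_scale (jacobian_column V I \<theta> p ` chart_states V)"

text \<open>
  Here \<open>\<real>\<^sup>k\<close> is \<open>powertop_real I\<close>, the real vectors indexed by a set \<open>I\<close> of size \<open>k = 2\<^bsup>|V|\<^esup> - 1\<close>.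
\<close>

definition smooth_parameterization ::
    "'a set \<Rightarrow> 'i set \<Rightarrow> ((('a \<Rightarrow> nat) \<Rightarrow> real) \<Rightarrow> 'i \<Rightarrow> real) \<Rightarrow> bool" where
  "smooth_parameterization V I \<theta> \<longleftrightarrow>
     finite I \<and> card I = 2 ^ card V - 1 \<and>
     (\<exists>\<Theta>. openin (powertop_real I) \<Theta> \<and>
          homeomorphic_map (simplex_top V) (subtopology (powertop_real I) \<Theta>) \<theta>) \<and>
     (\<forall>i\<in>I. cont_diff 2 V (\<lambda>p. \<theta> p i)) \<and>
     (\<forall>p\<in>pos_dists V. jacobian_rank V I \<theta> p = 2 ^ card V - 1)"

definition variation_independent :: "'a set \<Rightarrow> ('a set \<times> 'a set) set \<Rightarrow> bool" where
  "variation_independent V P \<longleftrightarrow> mll_vec V P ` pos_dists V = P \<rightarrow>\<^sub>E UNIV"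

end

theory Submission
  imports Defs
begin

text \<open>
  Write \<open>W = V - {v}\<close>. A positive distribution of \<open>X\<^sub>V\<close> is the same as a positive distribution \<open>q\<close> of
  \<open>X\<^sub>W\<close> together with the arbitrary log odds \<open>g\<close> of \<open>X\<^sub>v\<close> given \<open>X\<^sub>W\<close>. The effects containing \<open>v\<close> all
  have margin \<open>V\<close>, and their parameters form an invertible Hadamard transform of \<open>g\<close>. The other
  parameters are those of \<open>q\<close> for the reduced collection, translated by a function of \<open>g\<close>. Hence in
  the coordinates \<open>(q, g)\<close> the parameter map is the product of the reduced map and the identity,
  followed by a homeomorphic shear; injectivity, openness and surjectivity transfer in both directions.
  Every \<open>\<lambda>\<^sub>L\<^sup>M\<close> is smooth, and the Jacobian has full rank iff no nonzero tangent vector is annihilated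
  by all differentials, a condition that is compared directly for the two collections.
\<close>

section \<open>States, marginals and parity characters\<close>

abbreviation parity :: "'a set \<Rightarrow> ('a \<Rightarrow> nat) \<Rightarrow> real" where
  "parity L y \<equiv> (-1) ^ (\<Sum>v\<in>L. y v)"

lemma finite_states [simp]: "finite M \<Longrightarrow> finite (states M)"
  by (simp add: states_def finite_PiE)

lemma card_states: "finite M \<Longrightarrow> card (states M) = 2 ^ card M"
  unfolding states_def by (subst card_PiE) (auto simp: numeral_2_eq_2)

lemma zero_state_in_states [simp]: "zero_state M \<in> states M"
  by (auto simp: zero_state_def states_def)

lemma card_chart_states: "finite M \<Longrightarrow> card (chart_states M) = 2 ^ card M - 1"
  by (simp add: chart_states_def card_states)

lemma restrict_in_states: "x \<in> states V \<Longrightarrow> M \<subseteq> V \<Longrightarrow> restrict x M \<in> states M"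
  by (force simp: states_def PiE_iff)

lemma restrict_states_id: "x \<in> states M \<Longrightarrow> restrict x M = x"
  by (auto simp: states_def PiE_restrict)

lemma states_value_cases: "x \<in> states M \<Longrightarrow> i \<in> M \<Longrightarrow> x i = 0 \<or> x i = 1"
  by (auto simp: states_def PiE_iff)

lemma upd_in_states: "y \<in> states W \<Longrightarrow> a \<in> {0, 1} \<Longrightarrow> y(v := a) \<in> states (insert v W)"
  by (auto simp: states_def PiE_iff extensional_def)

lemma restrict_upd:
  assumes "y \<in> states W" "v \<notin> W"
  shows "restrict (y(v := a)) W = y"
  using assms by (auto simp: states_def PiE_iff extensional_def fun_eq_iff)

lemma upd_restrict:
  assumes "x \<in> states (insert v W)" "v \<notin> W"
  shows "(restrict x W)(v := x v) = x"
  using assms by (auto simp: states_def PiE_iff extensional_def fun_eq_iff)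

lemma states_insert_cases:
  assumes "x \<in> states (insert v W)" "v \<notin> W"
  obtains y where "y \<in> states W" "x = y(v := 0)" | y where "y \<in> states W" "x = y(v := 1)"
proof -
  have "restrict x W \<in> states W"
    using assms by (intro restrict_in_states[OF assms(1)]) auto
  moreover have "x v = 0 \<or> x v = 1"
    using assms by (intro states_value_cases) auto
  ultimately show ?thesis
    using that upd_restrict[OF assms] by metis
qed

lemma sum_states_insert:
  fixes F :: "('a \<Rightarrow> nat) \<Rightarrow> real"
  assumes "finite W" "v \<notin> W"
  shows "(\<Sum>x\<in>states (insert v W). F x) = (\<Sum>y\<in>states W. F (y(v := 0)) + F (y(v := 1)))"
proof -
  have "(\<Sum>x\<in>states (insert v W). F x) = (\<Sum>(a, y)\<in>{0, 1} \<times> states W. F (y(v := a)))"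
    unfolding states_def PiE_insert_eq
    by (subst sum.reindex[OF inj_combinator[OF assms(2)]]) (auto simp: case_prod_unfold)
  also have "\<dots> = (\<Sum>y\<in>states W. F (y(v := 0)) + F (y(v := 1)))"
    by (simp add: sum.cartesian_product[symmetric] sum.distrib)
  finally show ?thesis .
qed

section \<open>Marginals of functions on the states\<close>

lemma marginal_eq:
  assumes "finite V" "y \<in> states M"
  shows "marginal V M u y = (\<Sum>x\<in>states V. if restrict x M = y then u x else 0)"
  using assms by (simp add: marginal_def sum.inter_filter)

lemma marginal_cong: "(\<And>x. x \<in> states V \<Longrightarrow> u x = w x) \<Longrightarrow> marginal V M u = marginal V M w"
  by (auto simp: marginal_def intro!: sum.cong restrict_ext)

lemma marginal_self:
  assumes "finite W" "y \<in> states W"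
  shows "marginal W W u y = u y"
proof -
  have "marginal W W u y = (\<Sum>x\<in>states W. if x = y then u x else 0)"
    unfolding marginal_eq[OF assms] by (intro sum.cong) (auto simp: restrict_states_id)
  thus ?thesis using assms by simp
qed

lemma marginal_linear:
  assumes "y \<in> states M"
  shows "marginal V M (\<lambda>x. a * u x + b * w x) y = a * marginal V M u y + b * marginal V M w y"
  using assms by (simp add: marginal_def sum.distrib sum_distrib_left)

lemma marginal_pos:
  assumes "finite V" "p \<in> pos_dists V" "M \<subseteq> V" "y \<in> states M"
  shows "marginal V M p y > 0"
proof -
  \<comment> \<open>Padding \<open>y\<close> by zeros gives one state in the fibre over
    \<open>y\<close>, so the sum of positive terms is not empty.\<close>
  let ?x = "\<lambda>i\<in>V. if i \<in> M then y i else 0"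
  have "?x \<in> states V" "restrict ?x M = y"
    using assms by (auto simp: states_def PiE_iff fun_eq_iff extensional_def)
  hence "?x \<in> {x \<in> states V. restrict x M = y}" by simp
  thus ?thesis
    using assms by (auto simp: marginal_def pos_dists_def PiE_iff intro!: sum_pos)
qed

lemma sum_marginal:
  assumes "finite V" "M \<subseteq> V"
  shows "(\<Sum>y\<in>states M. marginal V M u y) = (\<Sum>x\<in>states V. u x)"
proof -
  have "finite M" using assms finite_subset by blast
  hence "(\<Sum>y\<in>states M. marginal V M u y) = (\<Sum>y\<in>states M. \<Sum>x | x \<in> states V \<and> restrict x M = y. u x)"
    by (intro sum.cong) (auto simp: marginal_def)
  also have "\<dots> = (\<Sum>x\<in>states V. u x)"
    using assms \<open>finite M\<close> by (intro sum.group) (auto intro: restrict_in_states)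
  finally show ?thesis .
qed

lemma marginal_in_pos_dists:
  assumes "finite V" "p \<in> pos_dists V" "M \<subseteq> V"
  shows "marginal V M p \<in> pos_dists M"
  using assms marginal_pos[OF assms] sum_marginal[OF assms(1,3), of p]
  by (auto simp: pos_dists_def PiE_iff) (auto simp: marginal_def)

lemma marginal_marginal_insert:
  assumes "finite W" "v \<notin> W" "M \<subseteq> W"
  shows "marginal (insert v W) M u = marginal W M (\<lambda>y. u (y(v := 0)) + u (y(v := 1)))"
proof
  fix m
  show "marginal (insert v W) M u m = marginal W M (\<lambda>y. u (y(v := 0)) + u (y(v := 1))) m"
  proof (cases "m \<in> states M")
    case True
    have r: "restrict (y(v := a)) M = restrict y M" for y :: "'a \<Rightarrow> nat" and a
      using assms by (auto simp: fun_eq_iff)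
    show ?thesis
      using assms True
      by (simp add: marginal_eq sum_states_insert r) (auto intro!: sum.cong)
  qed (simp add: marginal_def)
qed

lemma marginal_insert:
  assumes "finite W" "v \<notin> W" "y \<in> states W"
  shows "marginal (insert v W) W u y = u (y(v := 0)) + u (y(v := 1))"
  using assms by (simp add: marginal_marginal_insert marginal_self)

text \<open>The tower property of marginals. It makes a parameter whose margin lies in
  \<open>W\<close> depend on \<open>u\<close> only through the marginal on \<open>W\<close>.\<close>

lemma marginal_comp:
  assumes "finite W" "v \<notin> W" "M \<subseteq> W"
  shows "marginal (insert v W) M u = marginal W M (marginal (insert v W) W u)"
  unfolding marginal_marginal_insert[OF assms]
  by (intro marginal_cong) (simp add: marginal_insert assms)

section \<open>Parity characters, their orthogonality and Hadamard inversion\<close>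

lemma parity_upd:
  assumes "finite L" "v \<notin> L"
  shows "parity L (y(v := a)) = parity L y" "parity (insert v L) (y(v := a)) = (-1) ^ a * parity L y"
proof -
  have "sum (y(v := a)) L = sum y L"
    using assms by (intro sum.cong) auto
  thus "parity L (y(v := a)) = parity L y" "parity (insert v L) (y(v := a)) = (-1) ^ a * parity L y"
    using assms by (simp_all add: power_add)
qed

text \<open>Expanding the product over \<open>i\<close> in \<open>W\<close> of
  \<open>(-1) ^ x i * (-1) ^ y i + 1\<close> gives one term for each \<open>K\<close>. A coordinate
  where \<open>x\<close> and \<open>y\<close> differ contributes the factor \<open>-1 + 1\<close>;
  if there is none, every factor is \<open>2\<close>.\<close>

lemma sum_parity_effects:
  assumes "finite W" "x \<in> states W" "y \<in> states W"
  shows "(\<Sum>K\<in>Pow W. parity K x * parity K y) = (if x = y then 2 ^ card W else 0)"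
proof -
  have "(\<Sum>K\<in>Pow W. parity K x * parity K y) =
        (\<Sum>K\<in>Pow W. (\<Prod>i\<in>K. (-1) ^ x i * (-1) ^ y i) * (\<Prod>i\<in>W - K. 1))"
    by (simp add: power_sum prod.distrib)
  also have "\<dots> = (\<Prod>i\<in>W. (-1) ^ x i * (-1) ^ y i + (1::real))"
    by (rule prod_add[symmetric]) fact
  also have "\<dots> = (if x = y then 2 ^ card W else 0)"
  proof (cases "x = y")
    case True
    thus ?thesis by (simp add: power_mult_distrib[symmetric])
  next
    case False
    then obtain i where i: "i \<in> W" "x i \<noteq> y i"
      using assms by (metis states_def PiE_ext)
    hence "(-1) ^ x i * (-1) ^ y i + (1::real) = 0"
      using states_value_cases[OF assms(2)] states_value_cases[OF assms(3)] by fastforce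
    thus ?thesis using False i assms(1) by auto
  qed
  finally show ?thesis .
qed

text \<open>The dual orthogonality. The sum over states factors over coordinates, and a coordinate
  lying in exactly one of \<open>K\<close> and \<open>L\<close> contributes
  \<open>1 - 1\<close>.\<close>

lemma sum_parity_states:
  assumes "finite W" "K \<subseteq> W" "L \<subseteq> W"
  shows "(\<Sum>y\<in>states W. parity K y * parity L y) = (if K = L then 2 ^ card W else 0)"
proof -
  let ?f = "\<lambda>K i a. if i \<in> K then (-1::real) ^ a else 1"
  have p: "parity K y = (\<Prod>i\<in>W. ?f K i (y i))" if "K \<subseteq> W" for K y
    using that assms(1) by (simp add: power_sum prod.If_cases Int_absorb1)
  have "(\<Sum>y\<in>states W. parity K y * parity L y) =
        (\<Sum>y\<in>W \<rightarrow>\<^sub>E {0, 1::nat}. \<Prod>i\<in>W. ?f K i (y i) * ?f L i (y i))"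
    unfolding states_def p[OF assms(2)] p[OF assms(3)] prod.distrib ..
  also have "\<dots> = (\<Prod>i\<in>W. \<Sum>a\<in>{0, 1::nat}. ?f K i a * ?f L i a)"
    using assms(1) by (intro prod_sum_PiE[symmetric]) auto
  also have "\<dots> = (\<Prod>i\<in>W. if i \<in> K \<longleftrightarrow> i \<in> L then 2 else (0::real))"
    by (intro prod.cong) auto
  also have "\<dots> = (if K = L then 2 ^ card W else 0)"
  proof (cases "K = L")
    case False
    then obtain i where "i \<in> W" "(i \<in> K) \<noteq> (i \<in> L)" using assms by blast
    thus ?thesis using False assms(1) by auto
  qed simp
  finally show ?thesis .
qed

text \<open>Injectivity of the Hadamard transform: weighting the transforms by
  \<open>parity K x\<close> and summing over \<open>K\<close> recovers
  \<open>2 ^ card W * f x\<close>.\<close>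

lemma states_function_eq_0:
  fixes f :: "('a \<Rightarrow> nat) \<Rightarrow> real"
  assumes "finite W" "\<And>K. K \<subseteq> W \<Longrightarrow> (\<Sum>y\<in>states W. parity K y * f y) = 0" "x \<in> states W"
  shows "f x = 0"
proof -
  have "0 = (\<Sum>K\<in>Pow W. parity K x * (\<Sum>y\<in>states W. parity K y * f y))"
    using assms(2) by simp
  also have "\<dots> = (\<Sum>y\<in>states W. (\<Sum>K\<in>Pow W. parity K x * parity K y) * f y)"
    by (simp add: sum_distrib_left sum_distrib_right mult.assoc) (rule sum.swap)
  also have "\<dots> = (\<Sum>y\<in>states W. if x = y then 2 ^ card W * f y else 0)"
    using assms(1,3) by (intro sum.cong) (auto simp: sum_parity_effects)
  also have "\<dots> = 2 ^ card W * f x"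
    using assms(1,3) by simp
  finally show ?thesis by simp
qed

section \<open>Derivatives of the parameters\<close>

text \<open>The derivative of \<open>mll V L M\<close> at \<open>p\<close> in direction
  \<open>u\<close>: marginals are linear, and each logarithm contributes the relative change of its
  marginal.\<close>

definition mll_deriv :: "'a set \<Rightarrow> 'a set \<Rightarrow> 'a set \<Rightarrow> (('a \<Rightarrow> nat) \<Rightarrow> real) \<Rightarrow> (('a \<Rightarrow> nat) \<Rightarrow> real) \<Rightarrow> real" where
  "mll_deriv V L M p u =
     (1 / 2 ^ card M) * (\<Sum>y\<in>states M. parity L y * (marginal V M u y / marginal V M p y))"

text \<open>The velocity of \<open>move V x\<close>. For \<open>x\<close> in
  \<open>chart_states V\<close> it sums to zero over the states, that is, it is tangent to the
  simplex.\<close>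

definition unit_move :: "'a set \<Rightarrow> ('a \<Rightarrow> nat) \<Rightarrow> ('a \<Rightarrow> nat) \<Rightarrow> real" where
  "unit_move V x = (\<lambda>s. if s = x then 1 else if s = zero_state V then -1 else 0)"

text \<open>The factor \<open>1\<close> puts the right-hand side into the shape that
  \<open>marginal_linear\<close> rewrites.\<close>

lemma move_eq:
  assumes "x \<in> chart_states V"
  shows "move V x t p = (\<lambda>s. 1 * p s + t * unit_move V x s)"
  using assms by (auto simp: move_def unit_move_def chart_states_def)

lemma marginal_move:
  assumes "x \<in> chart_states V" "y \<in> states M"
  shows "marginal V M (move V x t p) y = marginal V M p y + t * marginal V M (unit_move V x) y"
  unfolding move_eq[OF assms(1)] marginal_linear[OF assms(2)] by simp

lemma sum_move:
  assumes "finite V" "x \<in> chart_states V"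
  shows "(\<Sum>s\<in>states V. move V x t p s) = (\<Sum>s\<in>states V. p s)"
proof -
  have "(\<Sum>s\<in>states V. unit_move V x s) =
        (\<Sum>s\<in>states V. (if s = x then 1 else 0) - (if s = zero_state V then 1 else 0))"
    using assms by (intro sum.cong) (auto simp: unit_move_def chart_states_def)
  also have "\<dots> = 0"
    using assms by (simp add: sum_subtractf chart_states_def)
  finally show ?thesis
    unfolding move_eq[OF assms(2)] sum.distrib sum_distrib_left[symmetric] by simp
qed

text \<open>The total mass is preserved, and positivity amounts to finitely many strict
  inequalities, each of which survives a small change of \<open>t\<close>.\<close>

lemma eventually_move_in_pos_dists:
  assumes "finite V" "x \<in> chart_states V" "p \<in> pos_dists V"
  shows "eventually (\<lambda>t. move V x t p \<in> pos_dists V) (nhds 0)"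
proof -
  have "eventually (\<lambda>t. \<forall>s\<in>states V. p s + t * unit_move V x s > 0) (nhds 0)"
  proof (intro eventually_ball_finite finite_states[OF assms(1)] ballI)
    fix s assume "s \<in> states V"
    hence "p s > 0" using assms(3) by (auto simp: pos_dists_def)
    have "((\<lambda>t. p s + t * unit_move V x s) \<longlongrightarrow> p s + 0 * unit_move V x s) (nhds 0)"
      by (intro tendsto_add tendsto_mult tendsto_const filterlim_ident)
    thus "eventually (\<lambda>t. p s + t * unit_move V x s > 0) (nhds 0)"
      using \<open>p s > 0\<close> by (simp add: order_tendstoD(1))
  qed
  thus ?thesis
  proof eventually_elim
    case (elim t)
    have "move V x t p \<in> extensional (states V)"
      using assms zero_state_in_states[of V]
      by (simp add: move_def extensional_def pos_dists_def PiE_iff chart_states_def)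
    moreover have "(\<Sum>s\<in>states V. move V x t p s) = 1"
      using sum_move[OF assms(1,2)] assms(3) by (simp add: pos_dists_def)
    ultimately show ?case
      using elim by (simp add: pos_dists_def PiE_iff move_eq[OF assms(2)])
  qed
qed

section \<open>Continuity and iterated partial derivatives on the simplex\<close>

lemma continuous_map_marginal:
  assumes "finite V" "y \<in> states M"
  shows "continuous_map (simplex_top V) euclideanreal (\<lambda>p. marginal V M p y)"
proof -
  have "continuous_map (simplex_top V) euclideanreal (\<lambda>p. \<Sum>x | x \<in> states V \<and> restrict x M = y. p x)"
    using assms(1)
    by (intro continuous_map_sum continuous_map_from_subtopology continuous_map_product_projection) auto
  thus ?thesis using assms(2) by (simp add: marginal_def)
qed

lemma pos_dists_subset [simp]: "(states V \<rightarrow>\<^sub>E UNIV) \<inter> pos_dists V = pos_dists V"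
  by (auto simp: pos_dists_def PiE_iff extensional_def)

lemma topspace_simplex [simp]: "topspace (simplex_top V) = pos_dists V"
  by simp

lemma eventually_eq_move:
  assumes "finite V" "\<And>p. p \<in> pos_dists V \<Longrightarrow> f p = g p" "x \<in> chart_states V" "p \<in> pos_dists V"
  shows "eventually (\<lambda>t. f (move V x t p) = g (move V x t p)) (nhds 0)"
  using eventually_move_in_pos_dists[OF assms(1,3,4)] by eventually_elim (rule assms(2))

text \<open>Short moves stay inside the simplex, so partial derivatives at its points depend only on
  values there. This allows a partial derivative to be replaced by a formula that is known only on
  \<open>pos_dists V\<close>.\<close>

lemma cont_diff_cong_imp:
  assumes "finite V" "\<And>p. p \<in> pos_dists V \<Longrightarrow> f p = g p" "cont_diff n V f"
  shows "cont_diff n V g"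
  using assms(2,3)
proof (induction n arbitrary: f g)
  case 0
  thus ?case by (auto intro: continuous_map_eq)
next
  case (Suc n)
  note ev = eventually_eq_move[where f = f and g = g, OF assms(1) Suc.prems(1), simplified]
  have "has_partials V g"
    unfolding has_partials_def
  proof (intro ballI)
    fix p x assume p: "p \<in> pos_dists V" and x: "x \<in> chart_states V"
    then obtain d where "((\<lambda>t. f (move V x t p)) has_real_derivative d) (at 0)"
      using Suc.prems(2) unfolding cont_diff.simps has_partials_def real_differentiable_def by blast
    hence "((\<lambda>t. g (move V x t p)) has_real_derivative d) (at 0)"
      using DERIV_cong_ev[OF refl ev[OF x p] refl] by blast
    thus "(\<lambda>t. g (move V x t p)) differentiable (at 0)"
      by (auto simp: real_differentiable_def)
  qed
  moreover have "cont_diff n V (partial V x g)" if x: "x \<in> chart_states V" for x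
  proof (rule Suc.IH)
    show "partial V x f p = partial V x g p" if "p \<in> pos_dists V" for p
      unfolding partial_def by (rule deriv_cong_ev[OF ev[OF x that] refl])
    show "cont_diff n V (partial V x f)" using Suc.prems(2) x by simp
  qed
  ultimately show ?case
    using Suc.prems by (auto intro: continuous_map_eq)
qed

text \<open>Each marginal is affine in \<open>t\<close>, so the chain rule yields a sum of the same
  shape with \<open>\<phi>'\<close> for \<open>\<phi>\<close> and rescaled coefficients. This
  closure under differentiation drives the induction for higher orders.\<close>

lemma has_derivative_marginal_sum:
  fixes \<phi> \<phi>' :: "real \<Rightarrow> real"
  assumes "finite V" "M \<subseteq> V" "p \<in> pos_dists V" "x \<in> chart_states V"
    and "\<And>t. t > 0 \<Longrightarrow> (\<phi> has_real_derivative \<phi>' t) (at t)"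
  shows "((\<lambda>t. \<Sum>y\<in>states M. c y * \<phi> (marginal V M (move V x t p) y)) has_real_derivative
          (\<Sum>y\<in>states M. (c y * marginal V M (unit_move V x) y) * \<phi>' (marginal V M p y))) (at 0)"
proof -
  have "((\<lambda>t. \<Sum>y\<in>states M. c y * \<phi> (marginal V M p y + t * marginal V M (unit_move V x) y))
          has_real_derivative
          (\<Sum>y\<in>states M. (c y * marginal V M (unit_move V x) y) * \<phi>' (marginal V M p y))) (at 0)"
  proof (rule DERIV_sum)
    fix y assume y: "y \<in> states M"
    have "((\<lambda>t. marginal V M p y + t * marginal V M (unit_move V x) y) has_real_derivative
             marginal V M (unit_move V x) y) (at 0)"
      by (auto intro!: derivative_eq_intros)
    moreover have "(\<phi> has_real_derivative \<phi>' (marginal V M p y))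
             (at (marginal V M p y + 0 * marginal V M (unit_move V x) y))"
      using assms marginal_pos[OF assms(1,3,2) y] by simp
    ultimately show "((\<lambda>t. c y * \<phi> (marginal V M p y + t * marginal V M (unit_move V x) y))
          has_real_derivative
          (c y * marginal V M (unit_move V x) y) * \<phi>' (marginal V M p y)) (at 0)"
      by (auto intro!: derivative_eq_intros DERIV_chain2[of \<phi>])
  qed
  thus ?thesis
    by (simp add: marginal_move[OF assms(4)])
qed

lemma continuous_map_compose_pos:
  assumes "continuous_map X euclideanreal f" "\<And>p. p \<in> topspace X \<Longrightarrow> f p > 0"
    and "continuous_on {0<..} \<phi>"
  shows "continuous_map X euclideanreal (\<lambda>p. \<phi> (f p))"
proof -
  have "continuous_map X (top_of_set {0<..}) f"
    using assms(1,2) by (auto intro: continuous_map_into_subtopology)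
  moreover have "continuous_map (top_of_set {0<..}) euclideanreal \<phi>"
    using assms(3) by simp
  ultimately show ?thesis
    by (metis (no_types, lifting) continuous_map_compose comp_apply continuous_map_eq)
qed

text \<open>Here \<open>\<phi> k\<close> plays the role of the \<open>k\<close>-th derivative of
  \<open>\<phi> 0\<close>. A partial derivative raises \<open>k\<close> by one and multiplies
  \<open>c y\<close> by a marginal of \<open>unit_move V x\<close>, so the induction must generalize
  over both \<open>c\<close> and \<open>k\<close>.\<close>

lemma cont_diff_marginal_sum:
  fixes \<phi> :: "nat \<Rightarrow> real \<Rightarrow> real"
  assumes "finite V" "M \<subseteq> V"
    and \<phi>: "\<And>k t. t > 0 \<Longrightarrow> (\<phi> k has_real_derivative \<phi> (Suc k) t) (at t)"
  shows "cont_diff n V (\<lambda>p. \<Sum>y\<in>states M. c y * \<phi> k (marginal V M p y))"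
proof (induction n arbitrary: c k)
  case *: 0
  have cont: "continuous_on {0<..} (\<phi> k)" for k
    using \<phi>[of _ k] by (intro continuous_at_imp_continuous_on) (auto intro: DERIV_isCont)
  have "continuous_map (simplex_top V) euclideanreal (\<lambda>p. \<phi> k (marginal V M p y))"
    if "y \<in> states M" for y k
    by (rule continuous_map_compose_pos[OF continuous_map_marginal[OF assms(1) that]])
       (simp_all add: marginal_pos assms(1,2) that cont)
  thus ?case
    unfolding cont_diff.simps using finite_subset[OF assms(2,1)]
    by (intro continuous_map_sum continuous_map_real_mult) auto
next
  case (Suc n)
  have d: "((\<lambda>t. \<Sum>y\<in>states M. c y * \<phi> k (marginal V M (move V x t p) y)) has_real_derivative
      (\<Sum>y\<in>states M. (c y * marginal V M (unit_move V x) y) * \<phi> (Suc k) (marginal V M p y))) (at 0)"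
    if "p \<in> pos_dists V" "x \<in> chart_states V" for p x
    by (rule has_derivative_marginal_sum[OF assms(1,2) that \<phi>])
  have "cont_diff 0 V (\<lambda>p. \<Sum>y\<in>states M. c y * \<phi> k (marginal V M p y))"
    using Suc.IH[of c k] by (cases n) auto
  moreover have "has_partials V (\<lambda>p. \<Sum>y\<in>states M. c y * \<phi> k (marginal V M p y))"
    unfolding has_partials_def real_differentiable_def by (intro ballI exI) (auto intro!: d)
  moreover have "cont_diff n V (partial V x (\<lambda>p. \<Sum>y\<in>states M. c y * \<phi> k (marginal V M p y)))"
    if "x \<in> chart_states V" for x
    by (rule cont_diff_cong_imp[OF assms(1) _ Suc.IH])
       (simp add: partial_def DERIV_imp_deriv[OF d] that)
  ultimately show ?case by simp
qed

lemma mll_eq: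
  "mll V L M p = (\<Sum>y\<in>states M. (parity L y / 2 ^ card M) * ln (marginal V M p y))"
  by (simp add: mll_def sum_distrib_left)

lemma cont_diff_mll:
  assumes "finite V" "M \<subseteq> V"
  shows "cont_diff n V (mll V L M)"
proof -
  \<comment> \<open>The successive derivatives of \<open>ln\<close>: the one of order
    \<open>Suc j\<close> is \<open>(-1) ^ j * fact j / t ^ Suc j\<close>.\<close>
  define \<phi> :: "nat \<Rightarrow> real \<Rightarrow> real" where
    "\<phi> k = (case k of 0 \<Rightarrow> ln | Suc j \<Rightarrow> (\<lambda>t. (-1) ^ j * fact j * inverse t ^ Suc j))" for k
  have "(\<phi> k has_real_derivative \<phi> (Suc k) t) (at t)" if "t > 0" for k t
  proof (cases k)
    case 0
    thus ?thesis using that by (auto simp: \<phi>_def intro!: derivative_eq_intros) (simp add: field_simps)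
  next
    case (Suc j)
    have "((\<lambda>t. (-1) ^ j * fact j * inverse t ^ Suc j) has_real_derivative
        (-1) ^ j * fact j * ((1 + real j) * (- (inverse t ^ Suc (Suc 0)) * inverse t ^ j))) (at t)"
      using that by (intro DERIV_cmult DERIV_power_Suc DERIV_inverse) auto
    thus ?thesis
      by (simp add: \<phi>_def Suc algebra_simps)
  qed
  from cont_diff_marginal_sum[where \<phi> = \<phi> and k = 0, OF assms this]
  have "cont_diff n V (\<lambda>p. \<Sum>y\<in>states M. (parity L y / 2 ^ card M) * ln (marginal V M p y))"
    unfolding \<phi>_def nat.case .
  thus ?thesis unfolding mll_eq[abs_def] .
qed

lemma partial_mll:
  assumes "finite V" "M \<subseteq> V" "p \<in> pos_dists V" "x \<in> chart_states V"
  shows "partial V x (mll V L M) p = mll_deriv V L M p (unit_move V x)"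
proof -
  have "(ln has_real_derivative inverse t) (at t)" if "t > 0" for t :: real
    using that DERIV_ln by auto
  from has_derivative_marginal_sum[OF assms this, of "\<lambda>y. parity L y / 2 ^ card M"]
  show ?thesis
    by (simp add: partial_def mll_eq[abs_def] DERIV_imp_deriv mll_deriv_def sum_distrib_left field_simps)
qed

section \<open>From the rank of the Jacobian to the kernel of the differential\<close>

lemma dim_image_eq_card_iff:
  fixes scale :: "'k::field \<Rightarrow> 'b::ab_group_add \<Rightarrow> 'b" and A :: "'c set"
  assumes "vector_space scale" "finite A"
  shows "vector_space.dim scale (f ` A) = card A \<longleftrightarrow>
         (\<forall>c. (\<Sum>x\<in>A. scale (c x) (f x)) = 0 \<longrightarrow> (\<forall>x\<in>A. c x = 0))" (is "?lhs = ?rhs")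
proof -
  interpret vector_space scale by fact
  show ?thesis
  proof
    assume ?lhs
    \<comment> \<open>A basis inside the image has \<open>card A\<close> elements, which leaves no
      room: it is the whole image, and \<open>f\<close> is injective on \<open>A\<close>.\<close>
    obtain B where B: "B \<subseteq> f ` A" "independent B" "card B = dim (f ` A)"
      using basis_exists by metis
    have "card (f ` A) \<le> card A" using assms(2) by (rule card_image_le)
    hence "B = f ` A"
      using B \<open>?lhs\<close> assms(2) by (intro card_seteq) auto
    hence "inj_on f A"
      using B(3) \<open>?lhs\<close> assms(2) by (intro eq_card_imp_inj_on) auto
    show ?rhs
    proof (intro allI impI ballI)
      fix c x assume c: "(\<Sum>x\<in>A. scale (c x) (f x)) = 0" and "x \<in> A"
      have "(\<Sum>b\<in>B. scale (c (the_inv_into A f b)) b) = (\<Sum>x\<in>A. scale (c x) (f x))"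
        unfolding \<open>B = f ` A\<close> sum.reindex[OF \<open>inj_on f A\<close>]
        by (intro sum.cong) (auto simp: the_inv_into_f_f[OF \<open>inj_on f A\<close>])
      hence "c (the_inv_into A f (f x)) = 0"
        using independentD[OF B(2), of B "\<lambda>b. c (the_inv_into A f b)" "f x"] assms(2) \<open>x \<in> A\<close> c
          \<open>B = f ` A\<close> by auto
      thus "c x = 0" using the_inv_into_f_f[OF \<open>inj_on f A\<close> \<open>x \<in> A\<close>] by simp
    qed
  next
    assume R: ?rhs
    have inj: "inj_on f A"
    proof (rule inj_onI, rule ccontr)
      fix x y assume xy: "x \<in> A" "y \<in> A" "f x = f y" "x \<noteq> y"
      \<comment> \<open>Two equal vectors with different indices give the nontrivial relation
        \<open>f x - f y = 0\<close>.\<close>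
      define c :: "'c \<Rightarrow> 'k" where "c z = (if z = x then 1 else if z = y then - 1 else 0)" for z
      have "(\<Sum>z\<in>A. scale (c z) (f z)) = (\<Sum>z\<in>{x, y}. scale (c z) (f z))"
        using xy assms(2) by (intro sum.mono_neutral_right) (auto simp: c_def)
      also have "\<dots> = 0" using xy by (simp add: c_def)
      finally have "c x = 0" using R xy(1) by blast
      thus False by (simp add: c_def)
    qed
    have "independent (f ` A)"
    proof (rule independent_if_scalars_zero)
      show "finite (f ` A)" using assms(2) by simp
      fix c b assume "(\<Sum>x\<in>f ` A. scale (c x) x) = 0" and b: "b \<in> f ` A"
      hence "(\<Sum>x\<in>A. scale (c (f x)) (f x)) = 0" by (simp add: sum.reindex[OF inj])
      with R[THEN spec, of "\<lambda>x. c (f x)"] have "\<forall>x\<in>A. c (f x) = 0" by (rule mp)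
      thus "c b = 0" using b by auto
    qed
    thus ?lhs
      using dim_eq_card_independent card_image[OF inj] by simp
  qed
qed

text \<open>Turns a linear relation among Jacobian columns into the vanishing of the differentials
  at a single combined direction.\<close>

lemma mll_deriv_sum:
  "mll_deriv V L M p (\<lambda>s. \<Sum>x\<in>A. c x * u x s) = (\<Sum>x\<in>A. c x * mll_deriv V L M p (u x))"
proof (induction A rule: infinite_finite_induct)
  case (insert a A)
  have "mll_deriv V L M p (\<lambda>s. c a * u a s + 1 * (\<Sum>x\<in>A. c x * u x s)) =
        c a * mll_deriv V L M p (u a) + mll_deriv V L M p (\<lambda>s. \<Sum>x\<in>A. c x * u x s)"
    by (simp add: mll_deriv_def marginal_linear[where b = 1, simplified] sum_distrib_left
        sum.distrib[symmetric] add_divide_distrib algebra_simps)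
  thus ?case using insert by simp
qed (simp_all add: mll_deriv_def marginal_def)

lemma mll_deriv_cong:
  "(\<And>x. x \<in> states V \<Longrightarrow> u x = w x) \<Longrightarrow> mll_deriv V L M p u = mll_deriv V L M p w"
  unfolding mll_deriv_def using marginal_cong[of V u w M] by simp

text \<open>The all-zero state absorbs minus the total of the coefficients. Thus coefficient vectors
  on the chart correspond to functions on the states with sum zero.\<close>

lemma sum_unit_move:
  assumes "finite V" "s \<in> states V"
  shows "(\<Sum>x\<in>chart_states V. c x * unit_move V x s) =
         (if s = zero_state V then - sum c (chart_states V) else c s)"
proof (cases "s = zero_state V")
  case True
  have "(\<Sum>x\<in>chart_states V. c x * unit_move V x s) = (\<Sum>x\<in>chart_states V. - c x)"
    using True by (intro sum.cong) (auto simp: unit_move_def chart_states_def)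
  thus ?thesis using True by (simp add: sum_negf)
next
  case False
  have "(\<Sum>x\<in>chart_states V. c x * unit_move V x s) = (\<Sum>x\<in>chart_states V. if x = s then c s else 0)"
    using False by (intro sum.cong) (auto simp: unit_move_def)
  thus ?thesis using False assms by (simp add: chart_states_def)
qed

lemma sum_states_chart:
  assumes "finite V"
  shows "sum u (states V) = u (zero_state V) + sum u (chart_states V)"
  unfolding chart_states_def using assms by (intro sum.remove) auto

text \<open>Injectivity of the differential on the tangent space of the simplex. This form mentions
  no chart, so it can be compared between two vertex sets.\<close>

definition regular_at :: "'a set \<Rightarrow> ('a set \<times> 'a set) set \<Rightarrow> (('a \<Rightarrow> nat) \<Rightarrow> real) \<Rightarrow> bool" where
  "regular_at V P p \<longleftrightarrow>
     (\<forall>u. sum u (states V) = 0 \<longrightarrow> (\<forall>(L, M)\<in>P. mll_deriv V L M p u = 0) \<longrightarrow> (\<forall>x\<in>states V. u x = 0))"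

lemma sum_fun_scale: "(\<Sum>x\<in>A. fun_scale (c x) (f x)) i = (\<Sum>x\<in>A. c x * f x i)"
  by (induction A rule: infinite_finite_induct) (auto simp: fun_scale_def)

lemma jacobian_rank_mll_vec_iff:
  assumes "finite V" "effect_margin_pairs V P" "p \<in> pos_dists V"
  shows "jacobian_rank V P (mll_vec V P) p = 2 ^ card V - 1 \<longleftrightarrow> regular_at V P p"
proof -
  let ?C = "chart_states V"
  have col: "jacobian_column V P (mll_vec V P) p x (L, M) = mll_deriv V L M p (unit_move V x)"
    if "x \<in> ?C" "(L, M) \<in> P" for x L M
    using assms that partial_mll[of V M p x L]
    by (auto simp: jacobian_column_def mll_vec_def effect_margin_pairs_def)
  have zero_iff: "(\<Sum>x\<in>?C. fun_scale (c x) (jacobian_column V P (mll_vec V P) p x)) = 0 \<longleftrightarrow>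
        (\<forall>(L, M)\<in>P. mll_deriv V L M p (\<lambda>s. \<Sum>x\<in>?C. c x * unit_move V x s) = 0)" for c
  proof -
    \<comment> \<open>Columns are \<open>0\<close> outside \<open>P\<close>, so a relation between
      them as functions on all pairs is a condition at the pairs of \<open>P\<close> alone.\<close>
    have "(\<Sum>x\<in>?C. c x * jacobian_column V P (mll_vec V P) p x i) = 0" if "i \<notin> P" for i
      using that by (simp add: jacobian_column_def)
    moreover have "(\<Sum>x\<in>?C. c x * jacobian_column V P (mll_vec V P) p x (L, M)) =
        mll_deriv V L M p (\<lambda>s. \<Sum>x\<in>?C. c x * unit_move V x s)" if "(L, M) \<in> P" for L M
      unfolding mll_deriv_sum by (intro sum.cong) (auto simp: col that)
    ultimately have "(\<Sum>x\<in>?C. c x * jacobian_column V P (mll_vec V P) p x (L, M)) = 0 \<longleftrightarrow>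
        ((L, M) \<in> P \<longrightarrow> mll_deriv V L M p (\<lambda>s. \<Sum>x\<in>?C. c x * unit_move V x s) = 0)" for L M
      by (cases "(L, M) \<in> P") simp_all
    thus ?thesis
      unfolding fun_eq_iff sum_fun_scale zero_fun_apply by (simp add: Ball_def)
  qed
  have "jacobian_rank V P (mll_vec V P) p = 2 ^ card V - 1 \<longleftrightarrow>
        (\<forall>c. (\<forall>(L, M)\<in>P. mll_deriv V L M p (\<lambda>s. \<Sum>x\<in>?C. c x * unit_move V x s) = 0) \<longrightarrow>
             (\<forall>x\<in>?C. c x = 0))"
    unfolding jacobian_rank_def card_chart_states[OF assms(1), symmetric] zero_iff[symmetric]
    by (rule dim_image_eq_card_iff[OF vector_space_fun_scale])
      (simp add: chart_states_def assms(1))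
  also have "\<dots> \<longleftrightarrow> regular_at V P p"
  proof
    assume *: "\<forall>c. (\<forall>(L, M)\<in>P. mll_deriv V L M p (\<lambda>s. \<Sum>x\<in>?C. c x * unit_move V x s) = 0) \<longrightarrow>
             (\<forall>x\<in>?C. c x = 0)"
    show "regular_at V P p"
      unfolding regular_at_def
    proof (intro allI impI)
      fix u assume u: "sum u (states V) = 0" "\<forall>(L, M)\<in>P. mll_deriv V L M p u = 0"
      \<comment> \<open>The coefficients can be the values of \<open>u\<close> itself: since
        \<open>u\<close> sums to zero, its value at the all-zero state is the one produced by
        \<open>sum_unit_move\<close>.\<close>
      have "(\<Sum>x\<in>?C. u x * unit_move V x s) = u s" if "s \<in> states V" for s
        using u(1) sum_unit_move[OF assms(1) that] sum_states_chart[OF assms(1), of u] by auto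
      hence "mll_deriv V L M p (\<lambda>s. \<Sum>x\<in>?C. u x * unit_move V x s) = mll_deriv V L M p u" for L M
        by (rule mll_deriv_cong)
      hence "\<forall>x\<in>?C. u x = 0" using * u(2) by simp
      thus "\<forall>x\<in>states V. u x = 0"
        using u(1) sum_states_chart[OF assms(1), of u] by (auto simp: chart_states_def)
    qed
  next
    assume R: "regular_at V P p"
    show "\<forall>c. (\<forall>(L, M)\<in>P. mll_deriv V L M p (\<lambda>s. \<Sum>x\<in>?C. c x * unit_move V x s) = 0) \<longrightarrow>
             (\<forall>x\<in>?C. c x = 0)"
    proof (intro allI impI ballI)
      fix c x
      let ?u = "\<lambda>s. \<Sum>x\<in>?C. c x * unit_move V x s"
      assume c: "\<forall>(L, M)\<in>P. mll_deriv V L M p ?u = 0" and x: "x \<in> ?C"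
      have u: "?u s = (if s = zero_state V then - sum c ?C else c s)" if "s \<in> states V" for s
        by (rule sum_unit_move[OF assms(1) that])
      have "sum ?u ?C = sum c ?C"
        by (rule sum.cong) (use u in \<open>auto simp: chart_states_def\<close>)
      hence "sum ?u (states V) = 0"
        using sum_states_chart[OF assms(1), of ?u] by (simp add: u)
      hence "?u x = 0" using R c x unfolding regular_at_def chart_states_def by blast
      thus "c x = 0" using u[of x] x by (auto simp: chart_states_def)
    qed
  qed
  finally show ?thesis .
qed

section \<open>Splitting sums and differentials at one additional vertex\<close>

lemma sum_parity_insert:
  assumes "finite W" "v \<notin> W" "K \<subseteq> W"
  shows "(\<Sum>x\<in>states (insert v W). parity K x * F x) =
           (\<Sum>y\<in>states W. parity K y * (F (y(v := 0)) + F (y(v := 1))))"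
    and "(\<Sum>x\<in>states (insert v W). parity (insert v K) x * F x) =
           (\<Sum>y\<in>states W. parity K y * (F (y(v := 0)) - F (y(v := 1))))"
proof -
  have K: "finite K" "v \<notin> K" using assms finite_subset by auto
  show "(\<Sum>x\<in>states (insert v W). parity K x * F x) =
           (\<Sum>y\<in>states W. parity K y * (F (y(v := 0)) + F (y(v := 1))))"
    unfolding sum_states_insert[OF assms(1,2)] parity_upd(1)[OF K] by (simp add: distrib_left)
  show "(\<Sum>x\<in>states (insert v W). parity (insert v K) x * F x) =
           (\<Sum>y\<in>states W. parity K y * (F (y(v := 0)) - F (y(v := 1))))"
    unfolding sum_states_insert[OF assms(1,2)] parity_upd(2)[OF K] by (simp add: right_diff_distrib)
qed

text \<open>For the full margin the marginals are \<open>p\<close> and \<open>u\<close> themselves.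
  Summing over the value at \<open>v\<close> shows that an effect without \<open>v\<close> sees the
  sum of the two relative changes \<open>u / p\<close>, and an effect with \<open>v\<close> their
  difference.\<close>

lemma mll_deriv_insert:
  assumes "finite W" "v \<notin> W"
  shows "M \<subseteq> W \<Longrightarrow> mll_deriv (insert v W) L M p u =
           mll_deriv W L M (marginal (insert v W) W p) (marginal (insert v W) W u)"
    and "K \<subseteq> W \<Longrightarrow> mll_deriv (insert v W) K (insert v W) p u = 1 / (2 * 2 ^ card W) *
           (\<Sum>y\<in>states W. parity K y * (u (y(v := 0)) / p (y(v := 0)) + u (y(v := 1)) / p (y(v := 1))))"
    and "K \<subseteq> W \<Longrightarrow> mll_deriv (insert v W) (insert v K) (insert v W) p u = 1 / (2 * 2 ^ card W) *
           (\<Sum>y\<in>states W. parity K y * (u (y(v := 0)) / p (y(v := 0)) - u (y(v := 1)) / p (y(v := 1))))"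
proof -
  show "M \<subseteq> W \<Longrightarrow> mll_deriv (insert v W) L M p u =
           mll_deriv W L M (marginal (insert v W) W p) (marginal (insert v W) W u)"
    by (simp add: mll_deriv_def marginal_comp[OF assms, symmetric])
  have "mll_deriv (insert v W) L (insert v W) p u =
      1 / (2 * 2 ^ card W) * (\<Sum>x\<in>states (insert v W). parity L x * (u x / p x))" for L
  proof -
    have "(\<Sum>x\<in>states (insert v W). parity L x * (marginal (insert v W) (insert v W) u x /
            marginal (insert v W) (insert v W) p x)) = (\<Sum>x\<in>states (insert v W). parity L x * (u x / p x))"
      using assms(1) by (intro sum.cong) (simp_all add: marginal_self)
    thus ?thesis unfolding mll_deriv_def using assms by simp
  qed
  note this[unfolded sum_parity_insert[OF assms]]
  thus "K \<subseteq> W \<Longrightarrow> mll_deriv (insert v W) K (insert v W) p u = 1 / (2 * 2 ^ card W) *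
           (\<Sum>y\<in>states W. parity K y * (u (y(v := 0)) / p (y(v := 0)) + u (y(v := 1)) / p (y(v := 1))))"
    and "K \<subseteq> W \<Longrightarrow> mll_deriv (insert v W) (insert v K) (insert v W) p u = 1 / (2 * 2 ^ card W) *
           (\<Sum>y\<in>states W. parity K y * (u (y(v := 0)) / p (y(v := 0)) - u (y(v := 1)) / p (y(v := 1))))"
    using sum_parity_insert[OF assms, of K "\<lambda>x. u x / p x"] by simp_all
qed

lemma mll_deriv_self:
  assumes "finite W"
  shows "mll_deriv W L W q w = 1 / 2 ^ card W * (\<Sum>y\<in>states W. parity L y * (w y / q y))"
proof -
  have "(\<Sum>y\<in>states W. parity L y * (marginal W W w y / marginal W W q y)) =
        (\<Sum>y\<in>states W. parity L y * (w y / q y))"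
    using assms by (intro sum.cong) (simp_all add: marginal_self)
  thus ?thesis unfolding mll_deriv_def by simp
qed

text \<open>Taking the effect is a bijection from \<open>P\<close> onto the nonempty subsets of
  \<open>V\<close>.\<close>

lemma complete_pairs_card:
  assumes "finite V" "complete_pairs V P"
  shows "finite P" "card P = 2 ^ card V - 1"
proof -
  have sub: "L \<noteq> {} \<and> L \<subseteq> V" if "(L, M) \<in> P" for L M
    using assms(2) that unfolding complete_pairs_def effect_margin_pairs_def by blast
  have ex1: "\<exists>!M. (L, M) \<in> P" if "L \<noteq> {} \<and> L \<subseteq> V" for L
    using assms(2) that by (simp add: complete_pairs_def)
  have "inj_on fst P"
  proof (rule inj_onI, clarify)
    fix L M L' M' assume "(L, M) \<in> P" "(L', M') \<in> P" "fst (L, M) = fst (L', M')"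
    thus "L = L' \<and> M = M'" using ex1[of L] sub[of L M] by (metis fst_conv)
  qed
  moreover have "L \<in> fst ` P \<longleftrightarrow> L \<noteq> {} \<and> L \<subseteq> V" for L
    using ex1[of L] sub[of L] unfolding image_iff by (metis fst_conv prod.collapse)
  ultimately have "bij_betw fst P (Pow V - {{}})" by (auto simp: bij_betw_def)
  thus "finite P" "card P = 2 ^ card V - 1"
    using assms(1) bij_betw_finite[of fst P] bij_betw_same_card[of fst P]
    by (auto simp: card_Pow)
qed

section \<open>A vertex that lies only in the full margin\<close>

text \<open>The full vertex set is written as \<open>insert v W\<close> so that states, sums and
  parities split at \<open>v\<close> by rewriting.\<close>

locale removable_vertex =
  fixes W :: "'a set" and v :: 'a and P :: "('a set \<times> 'a set) set"
  assumes finite_W: "finite W" and v_notin: "v \<notin> W"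
    and complete: "complete_pairs (insert v W) P"
    and margin: "(L, M) \<in> P \<Longrightarrow> M \<noteq> insert v W \<Longrightarrow> v \<notin> M"
begin

abbreviation V :: "'a set" where "V \<equiv> insert v W"

abbreviation Q :: "('a set \<times> 'a set) set" where "Q \<equiv> remove_vertex v P"

lemma finite_V: "finite V"
  using finite_W by simp

lemma pairD:
  assumes "(L, M) \<in> P"
  shows "L \<noteq> {}" "L \<subseteq> M" "M \<subseteq> V" "M = V \<or> M \<subseteq> W"
proof -
  have "\<forall>(L, M)\<in>P. L \<noteq> {} \<and> L \<subseteq> M \<and> M \<subseteq> V"
    using complete unfolding complete_pairs_def effect_margin_pairs_def by blast
  with assms show "L \<noteq> {}" "L \<subseteq> M" "M \<subseteq> V" by auto
  thus "M = V \<or> M \<subseteq> W" using margin[OF assms] by (auto simp: subset_insert)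
qed

lemma pair_unique: "(L, M) \<in> P \<Longrightarrow> (L, M') \<in> P \<Longrightarrow> M = M'"
  using pairD[of L M] complete unfolding complete_pairs_def by (metis order.trans)

lemma pair_exists: "L \<noteq> {} \<Longrightarrow> L \<subseteq> V \<Longrightarrow> \<exists>M. (L, M) \<in> P"
  using complete unfolding complete_pairs_def by metis

text \<open>A margin contains its effect, hence contains \<open>v\<close>, and the assumption
  \<open>margin\<close> then leaves only \<open>V\<close>.\<close>

lemma insert_pair: "K \<subseteq> W \<Longrightarrow> (insert v K, V) \<in> P"
proof -
  assume "K \<subseteq> W"
  then obtain M where M: "(insert v K, M) \<in> P" using pair_exists[of "insert v K"] by auto
  moreover have "v \<in> M" using pairD(2)[OF M] by simp
  ultimately show ?thesis using margin by metis
qed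

text \<open>The effects without \<open>v\<close> are the nonempty subsets of \<open>W\<close>. Each
  has one margin in \<open>P\<close>, and so only one after \<open>v\<close> has been
  deleted.\<close>

lemma complete_Q: "complete_pairs W Q"
  unfolding complete_pairs_def
proof (intro conjI allI impI)
  show "effect_margin_pairs W Q"
    unfolding effect_margin_pairs_def
  proof clarify
    fix L N assume "(L, N) \<in> Q"
    then obtain M where "(L, M) \<in> P" "v \<notin> L" "N = M - {v}"
      unfolding remove_vertex_def by blast
    thus "L \<noteq> {} \<and> L \<subseteq> N \<and> N \<subseteq> W" using pairD[of L M] by auto
  qed
  fix L assume L: "L \<noteq> {} \<and> L \<subseteq> W"
  then obtain M where "(L, M) \<in> P" using pair_exists by blast
  thus "\<exists>!N. (L, N) \<in> Q"
    using L v_notin by (intro ex1I[of _ "M - {v}"]) (auto simp: remove_vertex_def dest: pair_unique)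
qed

lemma Q_pair: "(L, M) \<in> P \<Longrightarrow> v \<notin> L \<Longrightarrow> (L, M - {v}) \<in> Q"
  by (auto simp: remove_vertex_def)

lemma Q_cases:
  assumes "(L, N) \<in> Q"
  obtains M where "(L, M) \<in> P" "L \<subseteq> W" "N = M - {v}"
proof -
  from assms obtain M where M: "(L, M) \<in> P" "v \<notin> L" "N = M - {v}"
    unfolding remove_vertex_def by blast
  moreover have "L \<subseteq> W" using pairD[OF M(1)] M(2) by auto
  ultimately show ?thesis using that by blast
qed

text \<open>The three kinds of pairs behave differently when \<open>v\<close> is removed: the first
  disappears, the second changes its margin from \<open>V\<close> to \<open>W\<close>, and the third
  is unchanged.\<close>

lemma pair_cases:
  assumes "(L, M) \<in> P"
  obtains K where "K \<subseteq> W" "L = insert v K" "M = V"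
    | "L \<subseteq> W" "M = V" "(L, W) \<in> Q" | "L \<subseteq> W" "M \<subseteq> W" "(L, M) \<in> Q"
proof -
  note pair = pairD[OF assms]
  consider "v \<in> L" | "v \<notin> L" "M = V" | "v \<notin> L" "M \<subseteq> W" using pair(4) by blast
  thus ?thesis
  proof cases
    case 1
    hence "M = V" "L - {v} \<subseteq> W" "L = insert v (L - {v})" using pair v_notin by auto
    thus ?thesis using that(1) by blast
  next
    case 2
    hence "M - {v} = W" "L \<subseteq> W" using pair v_notin by auto
    thus ?thesis using that(2) 2 Q_pair[OF assms] by metis
  next
    case 3
    hence "M - {v} = M" "L \<subseteq> W" using pair v_notin by auto
    thus ?thesis using that(3) 3 Q_pair[OF assms] by metis
  qed
qed

text \<open>A kernel vector \<open>w\<close> at \<open>q\<close> lifts to a kernel vector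
  \<open>u\<close> at some \<open>p\<close> such that the relative change \<open>u / p\<close>
  equals \<open>w / q\<close> at both values of \<open>v\<close>. Effects containing
  \<open>v\<close> then see the difference zero, and all others reproduce the reduced
  differentials.\<close>

lemma regular_V_imp_W:
  assumes reg: "\<forall>p\<in>pos_dists V. regular_at V P p" and q: "q \<in> pos_dists W"
  shows "regular_at W Q q"
  unfolding regular_at_def
proof (intro allI impI)
  fix w assume w: "sum w (states W) = 0" "\<forall>(L, N)\<in>Q. mll_deriv W L N q w = 0"
  \<comment> \<open>The vertex \<open>v\<close> becomes a fair coin independent of the rest, and the
    direction \<open>u\<close> below keeps it so.\<close>
  define p where "p = (\<lambda>x\<in>states V. q (restrict x W) / 2)"
  define u where "u x = w (restrict x W) / 2" for x
  have p_upd: "p (y(v := a)) = q y / 2" and u_upd: "u (y(v := a)) = w y / 2"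
    if "y \<in> states W" "a \<in> {0, 1}" for y a
    unfolding p_def u_def using that upd_in_states[OF that] restrict_upd[OF that(1) v_notin] by simp_all
  have "q (restrict x W) > 0" if "x \<in> states V" for x
    using q restrict_in_states[OF that, of W] by (auto simp: pos_dists_def)
  moreover have "sum p (states V) = sum q (states W)"
    by (simp add: sum_states_insert finite_W v_notin p_upd)
  ultimately have p: "p \<in> pos_dists V"
    using q by (auto simp: pos_dists_def p_def)
  have mp: "marginal V W p = q"
  proof
    fix y show "marginal V W p y = q y"
      using q by (cases "y \<in> states W")
        (auto simp: marginal_insert finite_W v_notin p_upd,
         auto simp: marginal_def pos_dists_def PiE_iff extensional_def)
  qed
  \<comment> \<open>The function \<open>w\<close> is arbitrary off the states, so it equals
    \<open>marginal V W u\<close> only on them; a congruence replaces rewriting.\<close>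
  have mu: "mll_deriv W L M q (marginal V W u) = mll_deriv W L M q w" for L M
    by (intro mll_deriv_cong) (simp add: marginal_insert finite_W v_notin u_upd)
  have "sum u (states V) = 0"
    using w(1) by (simp add: sum_states_insert finite_W v_notin u_upd)
  moreover have "\<forall>(L, M)\<in>P. mll_deriv V L M p u = 0"
  proof (intro ballI, clarify)
    fix L M assume "(L, M) \<in> P"
    thus "mll_deriv V L M p u = 0"
    proof (cases rule: pair_cases)
      case (1 K)
      thus ?thesis by (simp add: mll_deriv_insert(3) finite_W v_notin p_upd u_upd)
    next
      case 2
      \<comment> \<open>The two equal ratios add up to a factor \<open>2\<close>, which cancels the
        one by which \<open>2 ^ card V\<close> exceeds \<open>2 ^ card W\<close>.\<close>
      have "mll_deriv V L V p u = mll_deriv W L W q w"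
        unfolding mll_deriv_insert(2)[OF finite_W v_notin 2(1)] mll_deriv_self[OF finite_W]
        by (simp add: p_upd u_upd sum_distrib_left)
      thus ?thesis using 2 w(2) by auto
    next
      case 3
      thus ?thesis using w(2) by (auto simp: mll_deriv_insert(1) finite_W v_notin mp mu)
    qed
  qed
  ultimately have "\<forall>x\<in>states V. u x = 0"
    using reg p unfolding regular_at_def by blast
  thus "\<forall>y\<in>states W. w y = 0"
    using u_upd upd_in_states by fastforce
qed

text \<open>By Hadamard inversion the effects containing \<open>v\<close> force \<open>u / p\<close>
  to agree at both values of \<open>v\<close>. The common ratio is that of the marginals, so the
  remaining equations put the marginal of \<open>u\<close> into the kernel for \<open>Q\<close>;
  once it vanishes, so does \<open>u\<close>.\<close>

lemma regular_W_imp_V: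
  assumes reg: "\<forall>q\<in>pos_dists W. regular_at W Q q" and p: "p \<in> pos_dists V"
  shows "regular_at V P p"
  unfolding regular_at_def
proof (intro allI impI)
  fix u assume u: "sum u (states V) = 0" "\<forall>(L, M)\<in>P. mll_deriv V L M p u = 0"
  define q w where "q = marginal V W p" and "w = marginal V W u"
  have q: "q \<in> pos_dists W"
    unfolding q_def by (rule marginal_in_pos_dists[OF finite_V p]) blast
  have qy: "q y = p (y(v := 0)) + p (y(v := 1))" and wy: "w y = u (y(v := 0)) + u (y(v := 1))"
    if "y \<in> states W" for y
    unfolding q_def w_def using marginal_insert[OF finite_W v_notin that] by auto
  have pos: "p (y(v := a)) > 0" if "y \<in> states W" "a \<in> {0, 1}" for y a
    using p upd_in_states[OF that, of v] by (auto simp: pos_dists_def)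
  have ratio: "u (y(v := 0)) / p (y(v := 0)) = u (y(v := 1)) / p (y(v := 1))" if "y \<in> states W" for y
  proof -
    have "(\<Sum>y\<in>states W. parity K y *
            (u (y(v := 0)) / p (y(v := 0)) - u (y(v := 1)) / p (y(v := 1)))) = 0" if "K \<subseteq> W" for K
      using u(2) insert_pair[OF that] mll_deriv_insert(3)[OF finite_W v_notin that, of p u] by auto
    from states_function_eq_0[OF finite_W this that] show ?thesis by simp
  qed
  \<comment> \<open>Two equal fractions also equal their mediant, obtained by adding numerators and
    denominators, here \<open>w y / q y\<close>.\<close>
  have ratio0: "u (y(v := a)) / p (y(v := a)) = w y / q y" if "y \<in> states W" "a \<in> {0, 1}" for y a
    using ratio[OF that(1)] pos[OF that(1), of 0] pos[OF that(1), of 1] that(2)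
    by (auto simp: qy[OF that(1)] wy[OF that(1)] field_simps)
  have "sum w (states W) = 0"
    using u(1) sum_marginal[OF finite_V, of W u] by (auto simp: w_def)
  moreover have "\<forall>(L, N)\<in>Q. mll_deriv W L N q w = 0"
  proof (intro ballI, clarify)
    fix L N assume "(L, N) \<in> Q"
    then obtain M where M: "(L, M) \<in> P" "L \<subseteq> W" "N = M - {v}" by (rule Q_cases)
    hence z: "mll_deriv V L M p u = 0" using u(2) by auto
    show "mll_deriv W L N q w = 0"
    proof (cases "M = V")
      case True
      have "mll_deriv W L W q w = mll_deriv V L V p u"
        unfolding mll_deriv_insert(2)[OF finite_W v_notin M(2)] mll_deriv_self[OF finite_W]
        by (simp add: ratio0 sum_distrib_left)
      thus ?thesis using True M v_notin z by simp
    next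
      case False
      hence "M \<subseteq> W" "N = M" using pairD(4)[OF M(1)] M(3) v_notin by auto
      thus ?thesis using z mll_deriv_insert(1)[OF finite_W v_notin, of M L p u]
        by (simp add: q_def w_def)
    qed
  qed
  ultimately have "\<forall>y\<in>states W. w y = 0"
    using reg q unfolding regular_at_def by blast
  hence "u (y(v := a)) = 0" if "y \<in> states W" "a \<in> {0, 1}" for y a
    using ratio0[OF that] pos[OF that] that by auto
  thus "\<forall>x\<in>states V. u x = 0"
    using v_notin by (auto elim!: states_insert_cases)
qed

lemma full_rank_iff:
  "(\<forall>p\<in>pos_dists V. jacobian_rank V P (mll_vec V P) p = 2 ^ card V - 1) \<longleftrightarrow>
   (\<forall>q\<in>pos_dists W. jacobian_rank W Q (mll_vec W Q) q = 2 ^ card W - 1)"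
proof -
  have "effect_margin_pairs V P" "effect_margin_pairs W Q"
    using complete complete_Q by (simp_all add: complete_pairs_def)
  note iff = jacobian_rank_mll_vec_iff[OF finite_V this(1)] jacobian_rank_mll_vec_iff[OF finite_W this(2)]
  show ?thesis
    using iff regular_V_imp_W regular_W_imp_V by metis
qed

end

section \<open>Topological transfer\<close>

text \<open>The image of \<open>f\<close> serves as the open set. This turns the existential
  statement into three properties of \<open>f\<close> that can be transferred one at a time.\<close>

lemma homeomorphic_map_onto_open_iff:
  "(\<exists>\<Theta>. openin Y \<Theta> \<and> homeomorphic_map X (subtopology Y \<Theta>) f) \<longleftrightarrow>
   continuous_map X Y f \<and> open_map X Y f \<and> inj_on f (topspace X)"
proof
  assume "\<exists>\<Theta>. openin Y \<Theta> \<and> homeomorphic_map X (subtopology Y \<Theta>) f"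
  then obtain \<Theta> where \<Theta>: "openin Y \<Theta>" "homeomorphic_map X (subtopology Y \<Theta>) f" by blast
  show "continuous_map X Y f \<and> open_map X Y f \<and> inj_on f (topspace X)"
    using homeomorphic_imp_continuous_map[OF \<Theta>(2)] homeomorphic_imp_open_map[OF \<Theta>(2)]
      homeomorphic_imp_injective_map[OF \<Theta>(2)] open_map_from_open_subtopology[OF \<Theta>(1)]
    by (simp add: continuous_map_in_subtopology)
next
  assume f: "continuous_map X Y f \<and> open_map X Y f \<and> inj_on f (topspace X)"
  let ?\<Theta> = "f ` topspace X"
  have op: "openin Y ?\<Theta>" using f unfolding open_map_def by blast
  have "homeomorphic_map X (subtopology Y ?\<Theta>) f"
  proof (rule bijective_open_imp_homeomorphic_map)
    show "open_map X (subtopology Y ?\<Theta>) f"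
      using f op by (simp add: open_map_in_subtopology)
    show "f ` topspace X = topspace (subtopology Y ?\<Theta>)"
      using openin_subset[OF op] by auto
    show "continuous_map X (subtopology Y ?\<Theta>) f" "inj_on f (topspace X)"
      using f by (simp_all add: continuous_map_in_subtopology)
  qed
  thus "\<exists>\<Theta>. openin Y \<Theta> \<and> homeomorphic_map X (subtopology Y \<Theta>) f" using op by blast
qed

text \<open>In one direction the image of the cylinder over \<open>U\<close> is projected to
  \<open>Y\<close>; a point of \<open>Z\<close> is what makes \<open>U\<close> recoverable from its
  cylinder. In the other direction open boxes are mapped to open boxes.\<close>

lemma open_map_prod_id_iff:
  assumes "topspace Z \<noteq> {}"
  shows "open_map (prod_topology X Z) (prod_topology Y Z) (\<lambda>(x, z). (f x, z)) \<longleftrightarrow> open_map X Y f"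
    (is "open_map _ _ ?h \<longleftrightarrow> _")
proof
  assume h: "open_map (prod_topology X Z) (prod_topology Y Z) ?h"
  show "open_map X Y f"
    unfolding open_map_def
  proof (intro allI impI)
    fix U assume "openin X U"
    hence "openin (prod_topology X Z) (U \<times> topspace Z)"
      by (simp add: openin_prod_Times_iff)
    hence "openin Y (fst ` ?h ` (U \<times> topspace Z))"
      using h open_map_fst[of Y Z] by (simp add: open_map_def)
    moreover have "fst ` ?h ` (U \<times> topspace Z) = f ` fst ` (U \<times> topspace Z)"
      unfolding image_image by (rule image_cong) auto
    moreover have "fst ` (U \<times> topspace Z) = U"
      using assms by simp
    ultimately show "openin Y (f ` U)" by simp
  qed
next
  assume f: "open_map X Y f"
  show "open_map (prod_topology X Z) (prod_topology Y Z) ?h"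
    unfolding open_map_def
  proof (intro allI impI)
    fix S assume S: "openin (prod_topology X Z) S"
    show "openin (prod_topology Y Z) (?h ` S)"
      unfolding openin_prod_topology_alt
    proof (intro allI impI)
      fix y z assume "(y, z) \<in> ?h ` S"
      then obtain x where x: "(x, z) \<in> S" "y = f x" by auto
      then obtain U T where "openin X U" "openin Z T" "x \<in> U" "z \<in> T" "U \<times> T \<subseteq> S"
        using S unfolding openin_prod_topology_alt by metis
      moreover from this have "f ` U \<times> T \<subseteq> ?h ` S" by force
      ultimately show "\<exists>U T. openin Y U \<and> openin Z T \<and> y \<in> U \<and> z \<in> T \<and> U \<times> T \<subseteq> ?h ` S"
        using f x(2) unfolding open_map_def by (metis image_eqI)
    qed
  qed
qed

text \<open>Up to the coordinate changes \<open>s\<close> and \<open>t\<close> the maps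
  \<open>f\<close> and \<open>h\<close> are the same. Solving for \<open>h\<close> as
  \<open>t'\<close> after \<open>f\<close> after \<open>s'\<close> gives the converse for
  openness.\<close>

lemma homeomorphic_conjugation:
  assumes s: "homeomorphic_maps X X' s s'" and t: "homeomorphic_maps Y' Y t t'"
    and h: "h \<in> topspace X' \<rightarrow> topspace Y'" and f: "\<And>x. x \<in> topspace X \<Longrightarrow> f x = t (h (s x))"
  shows "open_map X Y f \<longleftrightarrow> open_map X' Y' h"
    and "inj_on f (topspace X) \<longleftrightarrow> inj_on h (topspace X')"
    and "f ` topspace X = topspace Y \<longleftrightarrow> h ` topspace X' = topspace Y'"
proof -
  note homeo = s[THEN homeomorphic_maps_imp_map] t[THEN homeomorphic_maps_imp_map]
    s[unfolded homeomorphic_maps_sym[of X], THEN homeomorphic_maps_imp_map]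
    t[unfolded homeomorphic_maps_sym[of Y'], THEN homeomorphic_maps_imp_map]
  note op = homeo[THEN homeomorphic_imp_open_map]
  have s_im: "s x \<in> topspace X'" "s' (s x) = x" if "x \<in> topspace X" for x
    using s that by (auto simp: homeomorphic_maps_def continuous_map_def)
  have s'_im: "s' x \<in> topspace X" "s (s' x) = x" if "x \<in> topspace X'" for x
    using s that by (auto simp: homeomorphic_maps_def continuous_map_def)
  have t_im: "t y \<in> topspace Y" "t' (t y) = y" if "y \<in> topspace Y'" for y
    using t that by (auto simp: homeomorphic_maps_def continuous_map_def)
  have t'_im: "t' y \<in> topspace Y'" "t (t' y) = y" if "y \<in> topspace Y" for y
    using t that by (auto simp: homeomorphic_maps_def continuous_map_def)
  have h_im: "h x \<in> topspace Y'" if "x \<in> topspace X'" for x using h that by auto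
  have h_eq: "h x = t' (f (s' x))" if "x \<in> topspace X'" for x
    using that by (simp add: f s'_im t_im h_im)
  show "open_map X Y f \<longleftrightarrow> open_map X' Y' h"
  proof
    assume "open_map X Y f"
    hence "open_map X' Y' (t' \<circ> (f \<circ> s'))"
      by (intro open_map_compose[OF open_map_compose[OF op(3)] op(4)])
    thus "open_map X' Y' h" by (rule open_map_eq) (simp add: h_eq)
  next
    assume "open_map X' Y' h"
    hence "open_map X Y (t \<circ> (h \<circ> s))"
      by (intro open_map_compose[OF open_map_compose[OF op(1)] op(2)])
    thus "open_map X Y f" by (rule open_map_eq) (simp add: f)
  qed
  show "inj_on f (topspace X) \<longleftrightarrow> inj_on h (topspace X')"
  proof
    assume inj: "inj_on f (topspace X)"
    show "inj_on h (topspace X')"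
      by (rule inj_onI) (metis f inj inj_onD s'_im)
  next
    assume inj: "inj_on h (topspace X')"
    show "inj_on f (topspace X)"
      by (rule inj_onI) (metis f inj inj_onD s_im t_im(2) h_im)
  qed
  have "f ` topspace X = t ` h ` topspace X'"
    using s_im s'_im by (auto simp: f image_iff) metis+
  \<comment> \<open>Since \<open>t\<close> is a bijection, surjectivity can be tested before
    applying it.\<close>
  moreover have "t ` A = topspace Y \<longleftrightarrow> A = topspace Y'" if "A \<subseteq> topspace Y'" for A
  proof
    assume A: "t ` A = topspace Y"
    show "A = topspace Y'"
    proof (intro equalityI that subsetI)
      fix y assume "y \<in> topspace Y'"
      then obtain a where "a \<in> A" "t y = t a" using A t_im by (metis imageE)
      thus "y \<in> A" using t_im(2) that \<open>y \<in> topspace Y'\<close> by (metis subsetD)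
    qed
  next
    assume "A = topspace Y'"
    thus "t ` A = topspace Y" using t_im t'_im by (auto simp: image_iff) metis
  qed
  ultimately show "f ` topspace X = topspace Y \<longleftrightarrow> h ` topspace X' = topspace Y'"
    using h_im by (metis image_subsetI)
qed

lemma continuous_map_restrict_powertop:
  assumes "\<And>i. i \<in> I \<Longrightarrow> continuous_map X euclideanreal (\<lambda>x. f x i)"
  shows "continuous_map X (powertop_real I) (\<lambda>x. restrict (f x) I)"
  unfolding continuous_map_componentwise using assms by auto

lemma continuous_map_compose_real:
  fixes \<phi> :: "real \<Rightarrow> real"
  assumes "continuous_on UNIV \<phi>" "continuous_map X euclideanreal f"
  shows "continuous_map X euclideanreal (\<lambda>x. \<phi> (f x))"
  using continuous_map_compose[OF assms(2), of euclideanreal \<phi>] assms(1) by (simp add: o_def)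

lemma continuous_map_fst_coord:
  "i \<in> I \<Longrightarrow> continuous_map (prod_topology (powertop_real I) Z) euclideanreal (\<lambda>z. fst z i)"
  using continuous_map_compose[OF continuous_map_fst continuous_map_product_projection[of i I]]
  by (simp add: o_def)

lemma continuous_map_snd_coord:
  "i \<in> I \<Longrightarrow> continuous_map (prod_topology Z (powertop_real I)) euclideanreal (\<lambda>z. snd z i)"
  using continuous_map_compose[OF continuous_map_snd continuous_map_product_projection[of i I]]
  by (simp add: o_def)

lemma continuous_map_fst_simplex:
  "y \<in> states M \<Longrightarrow> continuous_map (prod_topology (simplex_top M) Z) euclideanreal (\<lambda>z. fst z y)"
  using continuous_map_compose[OF continuous_map_fst
      continuous_map_from_subtopology[OF continuous_map_product_projection[of y "states M"]]]
  by (simp add: o_def)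

text \<open>The undifferentiated counterpart of \<open>mll_deriv_insert\<close>, with
  \<open>ln (p x)\<close> in place of \<open>u x / p x\<close>.\<close>

lemma mll_insert:
  assumes "finite W" "v \<notin> W"
  shows "M \<subseteq> W \<Longrightarrow> mll (insert v W) L M p = mll W L M (marginal (insert v W) W p)"
    and "K \<subseteq> W \<Longrightarrow> mll (insert v W) K (insert v W) p = 1 / (2 * 2 ^ card W) *
           (\<Sum>y\<in>states W. parity K y * (ln (p (y(v := 0))) + ln (p (y(v := 1)))))"
    and "K \<subseteq> W \<Longrightarrow> mll (insert v W) (insert v K) (insert v W) p = 1 / (2 * 2 ^ card W) *
           (\<Sum>y\<in>states W. parity K y * (ln (p (y(v := 0))) - ln (p (y(v := 1)))))"
proof -
  show "M \<subseteq> W \<Longrightarrow> mll (insert v W) L M p = mll W L M (marginal (insert v W) W p)"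
    by (simp add: mll_def marginal_comp[OF assms, symmetric])
  have "mll (insert v W) L (insert v W) p =
      1 / (2 * 2 ^ card W) * (\<Sum>x\<in>states (insert v W). parity L x * ln (p x))" for L
  proof -
    have "(\<Sum>x\<in>states (insert v W). parity L x * ln (marginal (insert v W) (insert v W) p x)) =
          (\<Sum>x\<in>states (insert v W). parity L x * ln (p x))"
      using assms(1) by (intro sum.cong) (simp_all add: marginal_self)
    thus ?thesis unfolding mll_def using assms by simp
  qed
  thus "K \<subseteq> W \<Longrightarrow> mll (insert v W) K (insert v W) p = 1 / (2 * 2 ^ card W) *
           (\<Sum>y\<in>states W. parity K y * (ln (p (y(v := 0))) + ln (p (y(v := 1)))))"
    and "K \<subseteq> W \<Longrightarrow> mll (insert v W) (insert v K) (insert v W) p = 1 / (2 * 2 ^ card W) *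
           (\<Sum>y\<in>states W. parity K y * (ln (p (y(v := 0))) - ln (p (y(v := 1)))))"
    using sum_parity_insert[OF assms, of K "\<lambda>x. ln (p x)"] by simp_all
qed

lemma mll_self:
  assumes "finite W"
  shows "mll W L W q = 1 / 2 ^ card W * (\<Sum>y\<in>states W. parity L y * ln (q y))"
proof -
  have "(\<Sum>y\<in>states W. parity L y * ln (marginal W W q y)) = (\<Sum>y\<in>states W. parity L y * ln (q y))"
    using assms by (intro sum.cong) (simp_all add: marginal_self)
  thus ?thesis unfolding mll_def by simp
qed

section \<open>Product coordinates: the marginal on \<open>W\<close> and the conditional log odds at
  \<open>v\<close>\<close>

context removable_vertex
begin

text \<open>The log odds of the value \<open>0\<close> against \<open>1\<close> at \<open>v\<close>
  given \<open>y\<close>: the marginal probability of \<open>y\<close> cancels in the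
  difference.\<close>

definition logit :: "(('a \<Rightarrow> nat) \<Rightarrow> real) \<Rightarrow> ('a \<Rightarrow> nat) \<Rightarrow> real" where
  "logit p = (\<lambda>y\<in>states W. ln (p (y(v := 0))) - ln (p (y(v := 1))))"

definition split_dist where
  "split_dist p = (marginal V W p, logit p)"

text \<open>The inverse of \<open>split_dist\<close>: the logistic function turns log odds into the
  conditional probabilities at \<open>v\<close>, which multiply the marginal.\<close>

definition join_dist ::
    "((('a \<Rightarrow> nat) \<Rightarrow> real) \<times> (('a \<Rightarrow> nat) \<Rightarrow> real)) \<Rightarrow> ('a \<Rightarrow> nat) \<Rightarrow> real" where
  "join_dist z = (\<lambda>x\<in>states V. fst z (restrict x W) *
     ((if x v = 0 then exp (snd z (restrict x W)) else 1) / (1 + exp (snd z (restrict x W)))))"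

lemma join_dist_upd:
  assumes "y \<in> states W"
  shows "join_dist z (y(v := 0)) = fst z y * (exp (snd z y) / (1 + exp (snd z y)))"
    and "join_dist z (y(v := 1)) = fst z y * (1 / (1 + exp (snd z y)))"
  using upd_in_states[OF assms, of 0 v] upd_in_states[OF assms, of 1 v]
  by (simp_all add: join_dist_def restrict_upd[OF assms v_notin])

lemma join_dist_sum:
  assumes "y \<in> states W"
  shows "join_dist z (y(v := 0)) + join_dist z (y(v := 1)) = fst z y"
proof -
  have "1 + exp (snd z y) \<noteq> 0" using exp_gt_zero[of "snd z y"] by linarith
  thus ?thesis
    unfolding join_dist_upd[OF assms] distrib_left[symmetric] add_divide_distrib[symmetric]
    by (simp add: add.commute)
qed

lemma pos_dists_upd:
  assumes "p \<in> pos_dists V" "y \<in> states W"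
  shows "p (y(v := 0)) > 0" "p (y(v := 1)) > 0"
  using assms(1) upd_in_states[OF assms(2), of 0 v] upd_in_states[OF assms(2), of 1 v]
  by (auto simp: pos_dists_def)

lemma join_dist_in_pos_dists:
  assumes "q \<in> pos_dists W"
  shows "join_dist (q, g) \<in> pos_dists V"
proof -
  have "sum (join_dist (q, g)) (states V) = sum q (states W)"
    unfolding sum_states_insert[OF finite_W v_notin]
    by (intro sum.cong refl) (simp only: join_dist_sum fst_conv)
  moreover have "join_dist (q, g) x > 0" if "x \<in> states V" for x
  proof -
    have "q (restrict x W) > 0"
      using assms restrict_in_states[OF that, of W] by (auto simp: pos_dists_def)
    thus ?thesis using that by (simp add: join_dist_def add_pos_pos)
  qed
  moreover have "join_dist (q, g) \<in> extensional (states V)"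
    by (simp add: join_dist_def)
  ultimately show ?thesis using assms by (simp add: pos_dists_def PiE_iff)
qed

lemma join_split:
  assumes "p \<in> pos_dists V"
  shows "join_dist (split_dist p) = p"
proof
  fix x
  show "join_dist (split_dist p) x = p x"
  proof (cases "x \<in> states V")
    case True
    have "exp (ln (p (y(v := 0))) - ln (p (y(v := 1)))) = p (y(v := 0)) / p (y(v := 1))"
      if "y \<in> states W" for y
      using pos_dists_upd[OF assms that] by (simp add: exp_diff)
    hence "join_dist (split_dist p) (y(v := 0)) = p (y(v := 0)) \<and>
          join_dist (split_dist p) (y(v := 1)) = p (y(v := 1))" if "y \<in> states W" for y
      unfolding join_dist_upd[OF that]
      using that pos_dists_upd[OF assms that] marginal_insert[OF finite_W v_notin that, of p]
      by (simp add: split_dist_def logit_def field_simps)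
    thus ?thesis using True v_notin by (metis states_insert_cases)
  next
    case False
    thus ?thesis using assms by (auto simp: join_dist_def pos_dists_def PiE_iff extensional_def)
  qed
qed

lemma split_join:
  assumes "q \<in> pos_dists W" "g \<in> extensional (states W)"
  shows "split_dist (join_dist (q, g)) = (q, g)"
proof -
  have "marginal V W (join_dist (q, g)) y = q y" for y
  proof (cases "y \<in> states W")
    case True
    thus ?thesis by (simp only: marginal_insert[OF finite_W v_notin] join_dist_sum fst_conv)
  next
    case False
    thus ?thesis using assms(1) by (simp add: marginal_def pos_dists_def PiE_iff extensional_def)
  qed
  moreover have "logit (join_dist (q, g)) y = g y" for y
  proof (cases "y \<in> states W")
    case True
    hence "q y > 0" using assms(1) by (auto simp: pos_dists_def)
    moreover have "1 + exp (g y) > 0" by (simp add: add_pos_pos)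
    ultimately show ?thesis
      unfolding logit_def restrict_apply'[OF True] join_dist_upd[OF True] by (simp add: ln_mult ln_div)
  next
    case False
    thus ?thesis using assms(2) by (simp add: logit_def extensional_def)
  qed
  ultimately show ?thesis by (auto simp: split_dist_def)
qed

lemma homeomorphic_split_dist:
  "homeomorphic_maps (simplex_top V) (prod_topology (simplex_top W) (powertop_real (states W)))
     split_dist join_dist"
  unfolding homeomorphic_maps_def
proof (intro conjI ballI)
  have coord: "continuous_map (simplex_top V) euclideanreal (\<lambda>p. p (y(v := a)))"
    if "y \<in> states W" "a \<in> {0, 1}" for y a
    using upd_in_states[OF that, of v]
    by (intro continuous_map_from_subtopology continuous_map_product_projection)
  have "continuous_map (simplex_top V) (simplex_top W) (\<lambda>p. marginal V W p)"
  proof (rule continuous_map_into_subtopology)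
    show "continuous_map (simplex_top V) (powertop_real (states W)) (marginal V W)"
      by (rule continuous_map_eq[OF continuous_map_restrict_powertop[OF continuous_map_marginal[OF finite_V]]])
        (auto simp: marginal_def)
    show "marginal V W \<in> topspace (simplex_top V) \<rightarrow> pos_dists W"
      using marginal_in_pos_dists[OF finite_V _ subset_insertI] by simp
  qed
  moreover have "continuous_map (simplex_top V) (powertop_real (states W)) logit"
    unfolding logit_def
  proof (intro continuous_map_restrict_powertop continuous_map_diff)
    fix y assume y: "y \<in> states W"
    have ln: "continuous_on {0<..} (ln :: real \<Rightarrow> real)"
      by (auto intro!: continuous_intros)
    show "continuous_map (simplex_top V) euclideanreal (\<lambda>p. ln (p (y(v := 0))))"
      by (rule continuous_map_compose_pos[OF coord[OF y] _ ln])
         (use pos_dists_upd[OF _ y] in \<open>simp_all del: fun_upd_apply\<close>)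
    show "continuous_map (simplex_top V) euclideanreal (\<lambda>p. ln (p (y(v := 1))))"
      by (rule continuous_map_compose_pos[OF coord[OF y] _ ln])
         (use pos_dists_upd[OF _ y] in \<open>simp_all del: fun_upd_apply\<close>)
  qed
  ultimately show "continuous_map (simplex_top V)
      (prod_topology (simplex_top W) (powertop_real (states W))) split_dist"
    unfolding split_dist_def by (rule continuous_map_pairedI)
  show "continuous_map (prod_topology (simplex_top W) (powertop_real (states W))) (simplex_top V) join_dist"
  proof (rule continuous_map_into_subtopology)
    show "continuous_map (prod_topology (simplex_top W) (powertop_real (states W)))
        (powertop_real (states V)) join_dist"
      unfolding join_dist_def
    proof (rule continuous_map_restrict_powertop)
      fix x assume "x \<in> states V"
      hence y: "restrict x W \<in> states W" by (rule restrict_in_states) blast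
      have "1 + exp t \<noteq> 0" for t :: real
        using exp_gt_zero[of t] by linarith
      hence e: "continuous_on UNIV (\<lambda>t::real. (if x v = 0 then exp t else 1) / (1 + exp t))"
        by (cases "x v = 0") (simp_all add: continuous_on_divide continuous_on_add continuous_on_exp)
      show "continuous_map (prod_topology (simplex_top W) (powertop_real (states W))) euclideanreal
          (\<lambda>z. fst z (restrict x W) * ((if x v = 0 then exp (snd z (restrict x W)) else 1) /
                 (1 + exp (snd z (restrict x W)))))"
        by (intro continuous_map_real_mult continuous_map_fst_simplex[OF y]
            continuous_map_compose_real[OF e continuous_map_snd_coord[OF y]])
    qed
    show "join_dist \<in> topspace (prod_topology (simplex_top W) (powertop_real (states W))) \<rightarrow> pos_dists V"
      using join_dist_in_pos_dists by auto
  qed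
  show "join_dist (split_dist p) = p" if "p \<in> topspace (simplex_top V)" for p
    using that join_split by simp
  show "split_dist (join_dist z) = z"
    if "z \<in> topspace (prod_topology (simplex_top W) (powertop_real (states W)))" for z
  proof -
    have "fst z \<in> pos_dists W" "snd z \<in> extensional (states W)"
      using that by (simp_all add: mem_Times_iff PiE_iff)
    from split_join[OF this] show ?thesis by simp
  qed
qed

text \<open>
  In the coordinates \<open>(q, g)\<close> one has \<open>ln p(y,0) + ln p(y,1) = 2 ln q(y) + g(y) - 2 ln (1 + exp (g y))\<close>,
  so for an effect without \<open>v\<close> the full margin only adds a function of \<open>g\<close>.
\<close>

definition shift :: "'a set \<Rightarrow> 'a set \<Rightarrow> (('a \<Rightarrow> nat) \<Rightarrow> real) \<Rightarrow> real" where
  "shift L M g = (if M = V then 1 / (2 * 2 ^ card W) *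
     (\<Sum>y\<in>states W. parity L y * (g y - 2 * ln (1 + exp (g y)))) else 0)"

text \<open>The map is triangular: its second argument can be read off from the effects containing
  \<open>v\<close>, and then determines the translation to subtract from the other
  coordinates.\<close>

definition shear ::
    "('a set \<times> 'a set \<Rightarrow> real) \<times> (('a \<Rightarrow> nat) \<Rightarrow> real) \<Rightarrow> 'a set \<times> 'a set \<Rightarrow> real" where
  "shear z = (\<lambda>i\<in>P. if v \<in> fst i
     then 1 / (2 * 2 ^ card W) * (\<Sum>y\<in>states W. parity (fst i - {v}) y * snd z y)
     else fst z (fst i, snd i - {v}) + shift (fst i) (snd i) (snd z))"

text \<open>A reduced pair with margin \<open>W\<close> may come from margin \<open>V\<close> or
  from \<open>W\<close> in \<open>P\<close>; the effect decides which.\<close>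

definition margin_of :: "'a set \<Rightarrow> 'a set" where
  "margin_of L = (THE M. (L, M) \<in> P)"

text \<open>Hadamard inversion. The factor \<open>2\<close> remains because \<open>shear\<close>
  divides by \<open>2 * 2 ^ card W\<close> while orthogonality supplies only
  \<open>2 ^ card W\<close>.\<close>

definition unshear_logit :: "('a set \<times> 'a set \<Rightarrow> real) \<Rightarrow> ('a \<Rightarrow> nat) \<Rightarrow> real" where
  "unshear_logit b = (\<lambda>y\<in>states W. 2 * (\<Sum>K\<in>Pow W. parity K y * b (insert v K, V)))"

definition unshear where
  "unshear b = ((\<lambda>i\<in>Q. b (fst i, margin_of (fst i)) - shift (fst i) (margin_of (fst i)) (unshear_logit b)),
     unshear_logit b)"

lemma margin_of_eq: "(L, M) \<in> P \<Longrightarrow> margin_of L = M"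
  unfolding margin_of_def by (rule the_equality) (auto dest: pair_unique)

lemma shear_insert:
  assumes "K \<subseteq> W"
  shows "shear z (insert v K, V) = 1 / (2 * 2 ^ card W) * (\<Sum>y\<in>states W. parity K y * snd z y)"
proof -
  have "insert v K - {v} = K" using assms v_notin by auto
  thus ?thesis using insert_pair[OF assms] by (simp add: shear_def)
qed

text \<open>Exchanging the sums brings in orthogonality over effects; the converse
  \<open>shear_unshear\<close> needs the one over states.\<close>

lemma unshear_logit_shear:
  assumes "snd z \<in> extensional (states W)"
  shows "unshear_logit (shear z) = snd z"
proof
  fix x
  show "unshear_logit (shear z) x = snd z x"
  proof (cases "x \<in> states W")
    case True
    have "(\<Sum>K\<in>Pow W. parity K x * (\<Sum>y\<in>states W. parity K y * snd z y)) =
          (\<Sum>y\<in>states W. (\<Sum>K\<in>Pow W. parity K x * parity K y) * snd z y)"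
      by (simp add: sum_distrib_left sum_distrib_right mult.assoc) (rule sum.swap)
    also have "\<dots> = (\<Sum>y\<in>states W. if x = y then 2 ^ card W * snd z y else 0)"
      using finite_W True by (intro sum.cong) (auto simp: sum_parity_effects)
    also have "\<dots> = 2 ^ card W * snd z x"
      using finite_W True by simp
    finally have *: "(\<Sum>K\<in>Pow W. parity K x * (\<Sum>y\<in>states W. parity K y * snd z y)) =
      2 ^ card W * snd z x" .
    have "unshear_logit (shear z) x =
        2 * (\<Sum>K\<in>Pow W. 1 / (2 * 2 ^ card W) * (parity K x * (\<Sum>y\<in>states W. parity K y * snd z y)))"
      using True unfolding unshear_logit_def restrict_apply'[OF True]
      by (intro arg_cong[of _ _ "\<lambda>t. 2 * t"] sum.cong) (simp_all add: shear_insert)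
    also have "\<dots> = snd z x"
      unfolding sum_distrib_left[symmetric] * by simp
    finally show ?thesis .
  next
    case False
    thus ?thesis using assms by (simp add: unshear_logit_def extensional_def)
  qed
qed

lemma unshear_shear:
  assumes "fst z \<in> extensional Q" "snd z \<in> extensional (states W)"
  shows "unshear (shear z) = z"
proof -
  have "fst (unshear (shear z)) i = fst z i" for i
  proof (cases "i \<in> Q")
    case True
    obtain L N where i: "i = (L, N)" by (cases i)
    with True obtain M where M: "(L, M) \<in> P" "L \<subseteq> W" "N = M - {v}" using Q_cases by blast
    moreover have "v \<notin> L" using M(2) v_notin by auto
    ultimately show ?thesis
      using True unfolding unshear_def unshear_logit_shear[OF assms(2)]
      by (simp add: i margin_of_eq shear_def)
  next
    case False
    thus ?thesis using extensional_arb[OF assms(1) False] by (simp add: unshear_def)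
  qed
  moreover have "snd (unshear (shear z)) = snd z"
    using unshear_logit_shear[OF assms(2)] by (simp add: unshear_def)
  ultimately show ?thesis by (intro prod_eqI) (rule ext)
qed

lemma shear_unshear:
  assumes "b \<in> extensional P"
  shows "shear (unshear b) = b"
proof
  fix i :: "'a set \<times> 'a set"
  obtain L M where i: "i = (L, M)" by (cases i)
  show "shear (unshear b) i = b i"
  proof (cases "i \<in> P")
    case True
    hence P: "(L, M) \<in> P" using i by simp
    show ?thesis
    proof (cases "v \<in> L")
      case False
      thus ?thesis using P Q_pair[OF P] by (simp add: i shear_def unshear_def margin_of_eq)
    next
      case True
      with P obtain K where K: "K \<subseteq> W" "L = insert v K" "M = V"
        using v_notin by (cases rule: pair_cases) auto
      have "(\<Sum>y\<in>states W. parity K y * unshear_logit b y) =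
            (\<Sum>y\<in>states W. \<Sum>J\<in>Pow W. 2 * (parity K y * parity J y * b (insert v J, V)))"
        by (intro sum.cong) (simp_all add: unshear_logit_def sum_distrib_left mult.assoc mult.left_commute)
      also have "\<dots> = (\<Sum>J\<in>Pow W. \<Sum>y\<in>states W. 2 * (parity K y * parity J y * b (insert v J, V)))"
        by (rule sum.swap)
      also have "\<dots> = (\<Sum>J\<in>Pow W. 2 * b (insert v J, V) * (\<Sum>y\<in>states W. parity K y * parity J y))"
        by (intro sum.cong refl) (simp add: sum_distrib_left mult_ac)
      also have "\<dots> = (\<Sum>J\<in>Pow W. if K = J then 2 * b (insert v J, V) * 2 ^ card W else 0)"
        using K(1) by (intro sum.cong refl) (simp add: sum_parity_states[OF finite_W])
      also have "\<dots> = 2 * 2 ^ card W * b (insert v K, V)"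
        using K(1) finite_W by simp
      finally show ?thesis
        unfolding i K(2,3) shear_insert[OF K(1)] by (simp add: unshear_def)
    qed
  next
    case False
    thus ?thesis using extensional_arb[OF assms False] by (simp add: shear_def)
  qed
qed

lemma continuous_map_shift:
  assumes "\<And>y. y \<in> states W \<Longrightarrow> continuous_map X euclideanreal (\<lambda>z. g z y)"
  shows "continuous_map X euclideanreal (\<lambda>z. shift L M (g z))"
proof -
  have "1 + exp t \<noteq> 0" for t :: real
    using exp_gt_zero[of t] by linarith
  hence "continuous_on UNIV (\<lambda>t::real. t - 2 * ln (1 + exp t))"
    by (auto intro!: continuous_intros)
  hence "continuous_map X euclideanreal (\<lambda>z. g z y - 2 * ln (1 + exp (g z y)))" if "y \<in> states W" for y
    by (rule continuous_map_compose_real) (rule assms[OF that])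
  thus ?thesis
    unfolding shift_def using finite_W
    by (cases "M = V")
       (simp_all, intro continuous_map_real_mult_left continuous_map_real_divide continuous_map_sum
         continuous_map_real_mult, auto)
qed

lemma homeomorphic_shear:
  "homeomorphic_maps (prod_topology (powertop_real Q) (powertop_real (states W))) (powertop_real P)
     shear unshear"
  unfolding homeomorphic_maps_def
proof (intro conjI ballI)
  show "continuous_map (prod_topology (powertop_real Q) (powertop_real (states W))) (powertop_real P) shear"
    unfolding shear_def
  proof (rule continuous_map_restrict_powertop)
    fix i assume "i \<in> P"
    then obtain L M where i: "i = (L, M)" "(L, M) \<in> P" by (cases i) auto
    show "continuous_map (prod_topology (powertop_real Q) (powertop_real (states W))) euclideanreal
        (\<lambda>z. if v \<in> fst i
           then 1 / (2 * 2 ^ card W) * (\<Sum>y\<in>states W. parity (fst i - {v}) y * snd z y)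
           else fst z (fst i, snd i - {v}) + shift (fst i) (snd i) (snd z))"
    proof (cases "v \<in> L")
      case True
      have "continuous_map (prod_topology (powertop_real Q) (powertop_real (states W))) euclideanreal
        (\<lambda>z. 1 / (2 * 2 ^ card W) * (\<Sum>y\<in>states W. parity (L - {v}) y * snd z y))"
        using finite_W
        by (intro continuous_map_real_mult_left continuous_map_sum continuous_map_snd_coord) auto
      thus ?thesis using True i by simp
    next
      case False
      have "continuous_map (prod_topology (powertop_real Q) (powertop_real (states W))) euclideanreal
        (\<lambda>z. fst z (L, M - {v}) + shift L M (snd z))"
        using Q_pair[OF i(2) False]
        by (intro continuous_map_add continuous_map_shift continuous_map_snd_coord continuous_map_fst_coord)
      thus ?thesis using False i by simp
    qed
  qed
  have logit: "continuous_map (powertop_real P) euclideanreal (\<lambda>b. unshear_logit b y)"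
    if "y \<in> states W" for y
    unfolding unshear_logit_def restrict_apply'[OF that] using finite_W insert_pair
    by (intro continuous_map_real_mult_left continuous_map_sum continuous_map_product_projection) auto
  have "continuous_map (powertop_real P) (powertop_real (states W)) unshear_logit"
    using logit unfolding continuous_map_componentwise by (auto simp: unshear_logit_def)
  moreover have "continuous_map (powertop_real P) (powertop_real Q)
      (\<lambda>b. \<lambda>i\<in>Q. b (fst i, margin_of (fst i)) - shift (fst i) (margin_of (fst i)) (unshear_logit b))"
  proof (intro continuous_map_restrict_powertop continuous_map_diff continuous_map_shift logit
      continuous_map_product_projection)
    fix i assume "i \<in> Q"
    then obtain L N where i: "i = (L, N)" "(L, N) \<in> Q" by (cases i) auto
    from Q_cases[OF i(2)] obtain M where "(L, M) \<in> P" by blast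
    thus "(fst i, margin_of (fst i)) \<in> P" by (simp add: i margin_of_eq)
  qed
  ultimately show "continuous_map (powertop_real P)
      (prod_topology (powertop_real Q) (powertop_real (states W))) unshear"
    unfolding unshear_def by (intro continuous_map_pairedI)
qed (auto simp: unshear_shear shear_unshear PiE_iff)

text \<open>The three kinds of pairs yield, in turn, the transformed log odds, a reduced parameter
  plus its translation, and a reduced parameter unchanged.\<close>

lemma mll_vec_factor:
  assumes p: "p \<in> pos_dists V"
  shows "mll_vec V P p = shear ((\<lambda>(q, g). (mll_vec W Q q, g)) (split_dist p))"
proof
  fix i :: "'a set \<times> 'a set"
  obtain L M where i: "i = (L, M)" by (cases i)
  let ?q = "marginal V W p"
  show "mll_vec V P p i = shear ((\<lambda>(q, g). (mll_vec W Q q, g)) (split_dist p)) i"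
  proof (cases "i \<in> P")
    case True
    hence P: "(L, M) \<in> P" using i by simp
    thus ?thesis
    proof (cases rule: pair_cases)
      case (1 K)
      have "(\<Sum>y\<in>states W. parity K y * logit p y) =
            (\<Sum>y\<in>states W. parity K y * (ln (p (y(v := 0))) - ln (p (y(v := 1)))))"
        by (intro sum.cong) (simp_all add: logit_def)
      thus ?thesis
        using P unfolding i 1(2,3) shear_insert[OF 1(1)]
        by (simp add: mll_vec_def mll_insert(3)[OF finite_W v_notin 1(1)] split_dist_def)
    next
      case 2
      \<comment> \<open>With \<open>a\<close> and \<open>b\<close> the two probabilities, the
        marginal is \<open>a + b\<close> and \<open>ln (1 + a / b) = ln (a + b) - ln b\<close>, so
        the terms in \<open>ln (a + b)\<close> cancel.\<close>
      have "ln (p (y(v := 0))) + ln (p (y(v := 1))) =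
          2 * ln (?q y) + (logit p y - 2 * ln (1 + exp (logit p y)))" if y: "y \<in> states W" for y
      proof -
        let ?a = "p (y(v := 0))" and ?b = "p (y(v := 1))"
        note pos = pos_dists_upd[OF p y]
        have "1 + exp (ln ?a - ln ?b) = (?a + ?b) / ?b"
          using pos by (simp add: exp_diff field_simps)
        hence "ln (1 + exp (ln ?a - ln ?b)) = ln (?a + ?b) - ln ?b"
          using pos by (simp add: ln_div)
        thus ?thesis using y by (simp add: logit_def marginal_insert[OF finite_W v_notin y])
      qed
      hence "(\<Sum>y\<in>states W. parity L y * (ln (p (y(v := 0))) + ln (p (y(v := 1))))) =
          (\<Sum>y\<in>states W. parity L y * (2 * ln (?q y) + (logit p y - 2 * ln (1 + exp (logit p y)))))"
        by (intro sum.cong refl) (simp only:)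
      also have "\<dots> = 2 * (\<Sum>y\<in>states W. parity L y * ln (?q y)) +
          (\<Sum>y\<in>states W. parity L y * (logit p y - 2 * ln (1 + exp (logit p y))))"
        by (simp add: sum_distrib_left sum.distrib[symmetric] algebra_simps)
      finally have "(\<Sum>y\<in>states W. parity L y * (ln (p (y(v := 0))) + ln (p (y(v := 1))))) =
          2 * (\<Sum>y\<in>states W. parity L y * ln (?q y)) +
          (\<Sum>y\<in>states W. parity L y * (logit p y - 2 * ln (1 + exp (logit p y))))" .
      hence "mll V L V p = mll W L W ?q + shift L V (logit p)"
        unfolding mll_insert(2)[OF finite_W v_notin 2(1)] mll_self[OF finite_W] shift_def
        by (simp add: field_simps)
      moreover have "V - {v} = W" "v \<notin> L" using v_notin 2(1) by auto
      ultimately show ?thesis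
        using P 2 by (simp add: i mll_vec_def split_dist_def shear_def)
    next
      case 3
      have "M - {v} = M" "v \<notin> L" "M \<noteq> V" using v_notin 3 by auto
      thus ?thesis
        using P 3 mll_insert(1)[OF finite_W v_notin 3(2), of L p]
        by (simp add: i mll_vec_def split_dist_def shear_def shift_def)
    qed
  next
    case False
    thus ?thesis by (simp add: mll_vec_def shear_def)
  qed
qed

text \<open>By \<open>mll_vec_factor\<close> the full map is conjugate to the reduced map times the
  identity on log odds. Each of the three properties passes through a product with the identity of a
  nonempty factor.\<close>

lemma mll_vec_transfer:
  shows "open_map (simplex_top V) (powertop_real P) (mll_vec V P) \<longleftrightarrow>
         open_map (simplex_top W) (powertop_real Q) (mll_vec W Q)"
    and "inj_on (mll_vec V P) (pos_dists V) \<longleftrightarrow> inj_on (mll_vec W Q) (pos_dists W)"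
    and "variation_independent V P \<longleftrightarrow> variation_independent W Q"
proof -
  let ?G = "states W \<rightarrow>\<^sub>E (UNIV :: real set)"
  let ?h = "\<lambda>(q, g). (mll_vec W Q q, g :: ('a \<Rightarrow> nat) \<Rightarrow> real)"
  have h: "?h \<in> topspace (prod_topology (simplex_top W) (powertop_real (states W))) \<rightarrow>
               topspace (prod_topology (powertop_real Q) (powertop_real (states W)))"
    by (auto simp: mll_vec_def)
  \<comment> \<open>Fixing one vector of log odds embeds the distributions on \<open>W\<close> into
    the product, which carries injectivity back to the first factor.\<close>
  obtain g0 where g0: "g0 \<in> ?G" by (metis PiE_eq_empty_iff UNIV_not_empty all_not_in_conv)
  hence ne: "?G \<noteq> {}" by blast
  note conj = homeomorphic_conjugation[OF homeomorphic_split_dist homeomorphic_shear h, of "mll_vec V P"]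
  show "open_map (simplex_top V) (powertop_real P) (mll_vec V P) \<longleftrightarrow>
        open_map (simplex_top W) (powertop_real Q) (mll_vec W Q)"
    using conj(1) mll_vec_factor open_map_prod_id_iff[of "powertop_real (states W)"] ne by simp
  have "inj_on ?h (pos_dists W \<times> ?G) \<longleftrightarrow> inj_on (mll_vec W Q) (pos_dists W)"
  proof
    assume inj: "inj_on ?h (pos_dists W \<times> ?G)"
    show "inj_on (mll_vec W Q) (pos_dists W)"
    proof (rule inj_onI)
      fix q q' assume "q \<in> pos_dists W" "q' \<in> pos_dists W" "mll_vec W Q q = mll_vec W Q q'"
      thus "q = q'" using inj_onD[OF inj, of "(q, g0)" "(q', g0)"] g0 by simp
    qed
  qed (auto simp: inj_on_def)
  thus "inj_on (mll_vec V P) (pos_dists V) \<longleftrightarrow> inj_on (mll_vec W Q) (pos_dists W)"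
    using conj(2) mll_vec_factor by simp
  have "?h ` (pos_dists W \<times> ?G) = (mll_vec W Q ` pos_dists W) \<times> ?G"
    by force
  hence "?h ` (pos_dists W \<times> ?G) = (Q \<rightarrow>\<^sub>E UNIV) \<times> ?G \<longleftrightarrow> mll_vec W Q ` pos_dists W = Q \<rightarrow>\<^sub>E UNIV"
    using ne by (auto simp: times_eq_iff)
  thus "variation_independent V P \<longleftrightarrow> variation_independent W Q"
    using conj(3) mll_vec_factor by (simp add: variation_independent_def)
qed

end

section \<open>Smoothness of the parameter vector and the final equivalences\<close>

lemma cont_diff_mll_vec:
  assumes "finite V" "effect_margin_pairs V P" "i \<in> P"
  shows "cont_diff n V (\<lambda>p. mll_vec V P p i)"
proof -
  obtain L M where i: "i = (L, M)" "M \<subseteq> V"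
    using assms by (cases i) (auto simp: effect_margin_pairs_def)
  thus ?thesis
    using cont_diff_mll[OF assms(1) i(2), of n L] assms(3) by (simp add: mll_vec_def)
qed

lemma continuous_map_mll_vec:
  assumes "finite V" "effect_margin_pairs V P"
  shows "continuous_map (simplex_top V) (powertop_real P) (mll_vec V P)"
  unfolding continuous_map_componentwise
  using cont_diff_mll_vec[OF assms, where n = 0] by (auto simp: mll_vec_def)

text \<open>Completeness gives the number of coordinates, and the parameters are smooth; the
  right-hand side lists the conditions left to compare between \<open>V\<close> and
  \<open>W\<close>.\<close>

lemma smooth_parameterization_mll_vec_iff:
  assumes "finite V" "complete_pairs V P"
  shows "smooth_parameterization V P (mll_vec V P) \<longleftrightarrow>
    open_map (simplex_top V) (powertop_real P) (mll_vec V P) \<and> inj_on (mll_vec V P) (pos_dists V) \<and>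
    (\<forall>p\<in>pos_dists V. jacobian_rank V P (mll_vec V P) p = 2 ^ card V - 1)"
proof -
  have "effect_margin_pairs V P" using assms(2) by (simp add: complete_pairs_def)
  thus ?thesis
    unfolding smooth_parameterization_def homeomorphic_map_onto_open_iff
    using complete_pairs_card[OF assms] cont_diff_mll_vec[OF assms(1)] continuous_map_mll_vec[OF assms(1)]
    by auto
qed

theorem proposition3p5:
  fixes V :: "'a set" and P :: "('a set \<times> 'a set) set" and v :: 'a
  assumes "finite V"
    and "complete_pairs V P"
    and "v \<in> V"
    and "\<forall>M\<in>margins P. M \<noteq> V \<longrightarrow> v \<notin> M"
  shows "(smooth_parameterization V P (mll_vec V P) \<longleftrightarrow>
            smooth_parameterization (V - {v}) (remove_vertex v P)
              (mll_vec (V - {v}) (remove_vertex v P))) \<and>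
         (variation_independent V P \<longleftrightarrow>
            variation_independent (V - {v}) (remove_vertex v P))"
proof -
  define W where "W = V - {v}"
  have V: "insert v W = V" using assms(3) by (auto simp: W_def)
  interpret removable_vertex W v P
  proof
    show "finite W" "v \<notin> W" using assms(1) by (simp_all add: W_def)
    show "complete_pairs (insert v W) P" using assms(2) V by simp
    show "v \<notin> M" if "(L, M) \<in> P" "M \<noteq> insert v W" for L M
      using assms(4) that V by (auto simp: margins_def)
  qed
  show ?thesis
    unfolding W_def[symmetric] unfolding V[symmetric] smooth_parameterization_mll_vec_iff[OF finite_V complete]
      smooth_parameterization_mll_vec_iff[OF finite_W complete_Q]
    using mll_vec_transfer full_rank_iff by simp
qed

end
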